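(* Let $C\subseteq\mathbb{R}$ be compact and of positive dimension. If $Y\subseteq\mathbb{R}$ contains a scaled copy of $K$ centered at $c$ for every $c\in C$, then $\dim Y>\dim K+\delta$, where $\delta>0$ depends only on $\dim C$ and $\dim K$. (That is: for every $s>0$ there is $\delta>0$ such that the inequality holds for every compact $C\subseteq\mathbb{R}$ with $\dim C=s$ and every such $Y$.)
   Context: $K$ is the middle-$1/3$ Cantor set translated so that it is symmetric around the origin (i.e. the standard middle-thirds Cantor set in $[0,1]$ translated by $-1/2$). A scaled copy of $K$ centered at $c$ is a set of the form $rK+c=\{rx+c: x\in K\}$ with $r>0$. $\dim$ is Hausdorff dimension. *)

theory Defs
  imports "HOL-Analysis.Analysis"
begin

(* The contribution of one covering set. The cases are split so that for s = 0 every nonempty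
   set counts 1 (note that 0 powr 0 = 0 in HOL) and the empty set always counts 0. *)
definition hausdorff_gauge :: "real \<Rightarrow> 'a::metric_space set \<Rightarrow> ennreal" where
  "hausdorff_gauge s U =
     (if U = {} then 0 else if s = 0 then 1 else ennreal (diameter U powr s))"

(* Boundedness is required explicitly because diameter is unspecified on unbounded sets.
   Finite covers are included, since the sets of a cover may be empty. *)
definition hausdorff_covers :: "real \<Rightarrow> 'a::metric_space set \<Rightarrow> (nat \<Rightarrow> 'a set) set" where
  "hausdorff_covers d A =
     {U. A \<subseteq> (\<Union>i. U i) \<and> (\<forall>i. bounded (U i) \<and> diameter (U i) \<le> d)}"

definition hausdorff_premeasure :: "real \<Rightarrow> real \<Rightarrow> 'a::metric_space set \<Rightarrow> ennreal" where
  "hausdorff_premeasure s d A = (INF U \<in> hausdorff_covers d A. \<Sum>i. hausdorff_gauge s (U i))"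

(* The limit for d tending to 0 is a supremum, since the premeasure increases as d decreases. *)
definition hausdorff_measure :: "real \<Rightarrow> 'a::metric_space set \<Rightarrow> ennreal" where
  "hausdorff_measure s A = (SUP d \<in> {0<..}. hausdorff_premeasure s d A)"

(* Defined for arbitrary sets, measurable or not; the empty set has dimension 0. *)
definition hausdorff_dim :: "'a::metric_space set \<Rightarrow> ennreal" where
  "hausdorff_dim A = Inf {ennreal s | s. 0 \<le> s \<and> hausdorff_measure s A = 0}"

(* The n-th stage of the middle-thirds construction, a union of 2 ^ n intervals
   of length 1 / 3 ^ n. *)
primrec cantor_stage :: "nat \<Rightarrow> real set" where
  "cantor_stage 0 = {0..1}"
| "cantor_stage (Suc n) =
     (\<lambda>x. x / 3) ` cantor_stage n \<union> (\<lambda>x. x / 3 + 2 / 3) ` cantor_stage n"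

definition cantor_set :: "real set" where
  "cantor_set = (\<Inter>n. cantor_stage n)"

definition centered_cantor_set :: "real set" where
  "centered_cantor_set = (\<lambda>x. x - 1 / 2) ` cantor_set"

definition scaled_copy :: "real \<Rightarrow> real \<Rightarrow> real set" where
  "scaled_copy r c = (\<lambda>x. r * x + c) ` centered_cantor_set"

end

theory Submission
  imports Defs
begin

text \<open>
  Let \<open>\<gamma> = ln 2 / ln 3\<close>. By countable subadditivity one may pass to a part of \<open>C\<close> that is still not
  negligible in a dimension \<open>s' < s\<close> and on which the radii agree up to a factor \<open>1 + 3\<^sup>-\<^sup>L\<close>. Put a
  finite Frostman weight on centres and the uniform weight on words of length \<open>k\<close>; the gain over \<open>\<gamma>\<close>
  comes from the energy, that is, from the probability that independent points \<open>c + r x\<close> and \<open>c' + r' x'\<close>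
  are \<open>3\<^sup>-\<^sup>k\<close>-close.

  Close pairs \<open>(x, x')\<close> with many differing digits are rare, because a difference sequence with \<open>h\<close>
  nonzero digits arises from only \<open>2\<^sup>k\<^sup>-\<^sup>h\<close> pairs, and in each window of \<open>L\<close> digits, where \<open>r\<close> and \<open>r'\<close> are
  indistinguishable, closeness leaves only boundedly many difference sequences. There are few
  difference sequences with few nonzero digits, and for each of them closeness means that the
  affine function \<open>c - c' + (r - r') x\<close> is close to a prescribed number, which for random \<open>c\<close> and \<open>x\<close> has
  small probability, by the Frostman property or because \<open>x\<close> is confined to a short interval.

  The Cauchy-Schwarz inequality converts the energy bound into a lower bound for the cost of every
  finite cover. To reduce to finite covers, the centres are exhausted by those whose (compact) copy
  is covered by the first \<open>N\<close> sets; the triadic net content is continuous along this increasing sequence.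
\<close>

section \<open>Words and ternary expansions\<close>

text \<open>Doubling the digits lets words over \<open>{0, 1}\<close> represent endpoints of the Cantor construction, and words
  over \<open>{-1, 0, 1}\<close> the differences of two such endpoints.\<close>

fun tval :: "int list \<Rightarrow> real" where
  "tval [] = 0"
| "tval (a # w) = (2 * of_int a + tval w) / 3"

fun ham :: "int list \<Rightarrow> int list \<Rightarrow> nat" where
  "ham (a # u) (b # v) = (if a = b then 0 else 1) + ham u v"
| "ham _ _ = 0"

definition words :: "int set \<Rightarrow> nat \<Rightarrow> int list set" where
  "words D k = {w. set w \<subseteq> D \<and> length w = k}"

lemma finite_words [simp]: "finite D \<Longrightarrow> finite (words D k)"
  unfolding words_def by (rule finite_lists_length_eq)

lemma card_words: "finite D \<Longrightarrow> card (words D k) = card D ^ k"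
  unfolding words_def by (rule card_lists_length_eq)

lemma words_0 [simp]: "words D 0 = {[]}"
  by (auto simp: words_def)

lemma words_append:
  "words D (m + n) = (\<lambda>(u, v). u @ v) ` (words D m \<times> words D n)"
proof (intro equalityI subsetI)
  fix w assume w: "w \<in> words D (m + n)"
  then have "take m w \<in> words D m" "drop m w \<in> words D n"
    by (auto simp: words_def dest: in_set_takeD in_set_dropD)
  then show "w \<in> (\<lambda>(u, v). u @ v) ` (words D m \<times> words D n)"
    by (intro image_eqI[of _ _ "(take m w, drop m w)"]) auto
qed (auto simp: words_def)

lemma sum_words_append:
  "(\<Sum>w\<in>words D (m + n). f w) = (\<Sum>u\<in>words D m. \<Sum>v\<in>words D n. f (u @ v))"
proof -
  have "inj_on (\<lambda>(u, v). u @ v) (words D m \<times> words D n)"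
    by (auto simp: inj_on_def words_def)
  then show ?thesis
    by (simp add: words_append sum.reindex sum.cartesian_product case_prod_unfold comp_def)
qed

lemma sum_words_Suc:
  "(\<Sum>w\<in>words D (Suc k). f w) = (\<Sum>a\<in>D. \<Sum>w\<in>words D k. f (a # w))"
proof -
  have "bij_betw (\<lambda>a. [a]) D (words D 1)"
    by (rule bij_betwI[where g = hd]) (auto simp: words_def length_Suc_conv)
  then have "(\<Sum>u\<in>words D 1. g u) = (\<Sum>a\<in>D. g [a])" for g :: "int list \<Rightarrow> 'a"
    by (rule sum.reindex_bij_betw[symmetric])
  then show ?thesis
    using sum_words_append[of f D 1 k] by simp
qed

lemma tval_append: "tval (u @ v) = tval u + tval v / 3 ^ length u"
  by (induction u) (auto simp: field_simps)

lemma ham_append: "length u = length u' \<Longrightarrow> ham (u @ v) (u' @ v') = ham u u' + ham v v'"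
  by (induction u u' rule: list_induct2) auto

lemma tval_bounds:
  assumes "w \<in> words {0, 1} k"
  shows "0 \<le> tval w" "tval w \<le> 1"
proof -
  have "set w \<subseteq> {0, 1} \<Longrightarrow> 0 \<le> tval w \<and> tval w \<le> 1"
    by (induction w) auto
  with assms show "0 \<le> tval w" "tval w \<le> 1"
    by (auto simp: words_def)
qed

section \<open>Signed words as balanced ternary integers\<close>

fun nval :: "int list \<Rightarrow> int" where
  "nval [] = 0"
| "nval (a # w) = a * 3 ^ length w + nval w"

lemma tval_eq_nval: "tval w * 3 ^ length w = 2 * of_int (nval w)"
  by (induction w) (auto simp: algebra_simps)

text \<open>The extreme value is the geometric sum \<open>(3 ^ k - 1) / 2\<close>, reached by a
  constant word. The strict inequality is what lets \<open>inj_on_nval\<close> recover the leading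
  digit.\<close>

lemma nval_bound: "w \<in> words {-1, 0, 1} k \<Longrightarrow> 2 * \<bar>nval w\<bar> < 3 ^ k"
proof (induction k arbitrary: w)
  case (Suc k)
  then obtain a v where w: "w = a # v" "v \<in> words {-1, 0, 1} k" "a \<in> {-1, 0, 1}"
    by (auto simp: words_def length_Suc_conv)
  with Suc.IH[of v] show ?case
    by (auto simp: words_def)
qed auto

text \<open>Balanced ternary expansions of fixed length are unique: two tails of length
  \<open>k\<close> differ in value by less than \<open>3 ^ k\<close>, so equal values force equal
  leading digits.\<close>

lemma inj_on_nval: "inj_on nval (words {-1, 0, 1} k)"
proof (induction k)
  case (Suc k)
  show ?case
  proof (rule inj_onI)
    fix w w' assume ww: "w \<in> words {-1, 0, 1} (Suc k)" "w' \<in> words {-1, 0, 1} (Suc k)"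
      and eq: "nval w = nval w'"
    obtain a v where w: "w = a # v" "v \<in> words {-1, 0, 1} k" "a \<in> {-1, 0, 1}"
      using ww by (auto simp: words_def length_Suc_conv)
    obtain a' v' where w': "w' = a' # v'" "v' \<in> words {-1, 0, 1} k" "a' \<in> {-1, 0, 1}"
      using ww by (auto simp: words_def length_Suc_conv)
    have "length v = k" "length v' = k"
      using w w' by (auto simp: words_def)
    then have "(a - a') * 3 ^ k = nval v' - nval v"
      using eq w w' by (simp add: algebra_simps)
    moreover have "\<bar>nval v' - nval v\<bar> < 3 ^ k"
      using nval_bound[OF w(2)] nval_bound[OF w'(2)] by linarith
    ultimately have "\<bar>a - a'\<bar> * 3 ^ k < 1 * 3 ^ k"
      by (metis abs_mult abs_of_nonneg mult_1 zero_le_numeral zero_le_power)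
    then have "\<bar>a - a'\<bar> < 1"
      by (simp only: mult_less_cancel_right) auto
    then have "a = a'" by simp
    moreover have "v = v'"
      using Suc.IH eq w w' \<open>a = a'\<close> \<open>length v = k\<close> \<open>length v' = k\<close>
      by (auto simp: inj_on_def)
    ultimately show "w = w'" using w w' by simp
  qed
qed simp

text \<open>The values \<open>2 * j\<close> lie in an interval of length \<open>2 * b\<close>, so
  \<open>j\<close> itself is confined to one of length \<open>b\<close>.\<close>

lemma card_int_interval:
  fixes Z :: real
  assumes "0 \<le> b" and "S \<subseteq> {j::int. \<bar>Z + 2 * of_int j\<bar> \<le> b}"
  shows "real (card S) \<le> b + 1"
proof -
  define l where "l = \<lceil>(- b - Z) / 2\<rceil>"
  define h where "h = \<lfloor>(b - Z) / 2\<rfloor>"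
  have "S \<subseteq> {l..h}"
    using assms by (force simp: l_def h_def le_floor_iff ceiling_le_iff)
  then have "card S \<le> nat (h - l + 1)"
    using card_mono[of "{l..h}" S] by simp
  also have "real (nat (h - l + 1)) \<le> b + 1"
  proof (cases "h - l + 1 \<ge> 0")
    case True
    have "of_int h \<le> (b - Z) / 2" "of_int l \<ge> (- b - Z) / 2"
      unfolding h_def l_def by (rule of_int_floor_le, rule le_of_int_ceiling)
    with True show ?thesis by (simp add: field_simps)
  qed (use assms in auto)
  finally show "real (card S) \<le> b + 1" by simp
qed

text \<open>Multiplied by \<open>3 ^ k\<close>, the values \<open>tval e\<close> become distinct
  even integers in an interval of length \<open>2 * b\<close>. The bound is free of
  \<open>k\<close>; this is how closeness leaves only boundedly many difference words.\<close>

lemma card_words_near: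
  fixes z :: real
  assumes "0 \<le> b" "D \<subseteq> {-1, 0, 1}"
  shows "real (card {e \<in> words D k. \<bar>z + tval e\<bar> \<le> b / 3 ^ k}) \<le> b + 1"
proof -
  let ?S = "{e \<in> words D k. \<bar>z + tval e\<bar> \<le> b / 3 ^ k}"
  have sub: "?S \<subseteq> words {-1, 0, 1} k"
    using assms(2) by (auto simp: words_def)
  have "nval ` ?S \<subseteq> {j. \<bar>z * 3 ^ k + 2 * of_int j\<bar> \<le> b}"
  proof clarify
    fix e assume e: "e \<in> words D k" "\<bar>z + tval e\<bar> \<le> b / 3 ^ k"
    then have "length e = k" by (simp add: words_def)
    then have "z * 3 ^ k + 2 * of_int (nval e) = (z + tval e) * 3 ^ k"
      using tval_eq_nval[of e] by (simp add: algebra_simps)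
    also have "\<bar>\<dots>\<bar> = \<bar>z + tval e\<bar> * 3 ^ k"
      by (simp add: abs_mult)
    also have "\<dots> \<le> b"
      using e(2) by (simp add: field_simps)
    finally show "\<bar>z * 3 ^ k + 2 * of_int (nval e)\<bar> \<le> b" .
  qed
  then have "real (card (nval ` ?S)) \<le> b + 1"
    using card_int_interval assms(1) by blast
  moreover have "card (nval ` ?S) = card ?S"
    by (rule card_image) (rule inj_on_subset[OF inj_on_nval sub])
  ultimately show ?thesis by simp
qed

text \<open>The digit difference 0 arises from two pairs of digits and each of 1 and -1 from a
  single pair, so the weight \<open>2 ^ ham u v\<close> makes all difference words equally heavy.
  The function \<open>\<phi>\<close> varies in the induction because the leading digit shifts and
  rescales its argument.\<close>

lemma sum_pairs_by_difference:
  fixes \<phi> :: "real \<Rightarrow> real"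
  shows "(\<Sum>u\<in>words {0, 1} k. \<Sum>v\<in>words {0, 1} k. 2 ^ ham u v * \<phi> (tval u - tval v))
    = 2 ^ k * (\<Sum>e\<in>words {-1, 0, 1} k. \<phi> (tval e))"
proof (induction k arbitrary: \<phi>)
  case (Suc k)
  have IH: "(\<Sum>u\<in>words {0, 1} k. \<Sum>v\<in>words {0, 1} k. 2 ^ ham u v * \<phi> ((d + tval u - tval v) / 3))
    = 2 ^ k * (\<Sum>e\<in>words {-1, 0, 1} k. \<phi> ((d + tval e) / 3))" for d
    using Suc.IH[of "\<lambda>x. \<phi> ((d + x) / 3)"] by (simp add: add_diff_eq)
  have step: "(\<Sum>u\<in>words {0, 1} k. \<Sum>v\<in>words {0, 1} k.
        2 ^ ham (a # u) (b # v) * \<phi> (tval (a # u) - tval (b # v)))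
    = (if a = b then 1 else 2) *
      (2 ^ k * (\<Sum>e\<in>words {-1, 0, 1} k. \<phi> ((2 * of_int (a - b) + tval e) / 3)))" for a b
    unfolding IH[of "2 * of_int (a - b)", symmetric] unfolding sum_distrib_left
    by (intro sum.cong refl) (auto simp: algebra_simps diff_divide_distrib add_divide_distrib)
  have "(\<Sum>u\<in>words {0, 1} (Suc k). \<Sum>v\<in>words {0, 1} (Suc k). 2 ^ ham u v * \<phi> (tval u - tval v))
    = (\<Sum>a\<in>{0,1}. \<Sum>b\<in>{0,1}. \<Sum>u\<in>words {0, 1} k. \<Sum>v\<in>words {0, 1} k.
        2 ^ ham (a # u) (b # v) * \<phi> (tval (a # u) - tval (b # v)))"
    unfolding sum_words_Suc by (intro sum.cong refl sum.swap)
  also have "\<dots> = (\<Sum>a\<in>{0,1}. \<Sum>b\<in>{0,1}. (if a = b then 1 else 2) *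
      (2 ^ k * (\<Sum>e\<in>words {-1, 0, 1} k. \<phi> ((2 * of_int (a - b) + tval e) / 3))))"
    by (intro sum.cong refl step)
  also have "\<dots> = 2 ^ Suc k * (\<Sum>e\<in>words {-1, 0, 1} (Suc k). \<phi> (tval e))"
    unfolding sum_words_Suc by (simp add: algebra_simps)
  finally show ?case .
qed simp

fun nz :: "int list \<Rightarrow> nat" where
  "nz [] = 0"
| "nz (a # w) = (if a = 0 then 0 else 1) + nz w"

text \<open>The distance \<open>ham u v\<close> is the number of nonzero digits of the difference
  word \<open>e\<close>. A word \<open>u\<close> and a difference \<open>e\<close> determine
  \<open>v\<close>, if it exists, which allows \<open>\<psi>\<close> to depend on \<open>u\<close>
  as well; letting \<open>u\<close> and \<open>e\<close> range freely only adds nonnegative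
  terms.\<close>

lemma sum_pairs_le_by_difference:
  fixes \<psi> :: "int list \<Rightarrow> real \<Rightarrow> real"
  assumes "\<And>u x. 0 \<le> \<psi> u x" "0 \<le> q"
  shows "(\<Sum>u\<in>words {0, 1} k. \<Sum>v\<in>words {0, 1} k. q ^ ham u v * \<psi> u (tval u - tval v))
    \<le> (\<Sum>e\<in>words {-1, 0, 1} k. q ^ nz e * (\<Sum>u\<in>words {0, 1} k. \<psi> u (tval e)))"
  using assms(1)
proof (induction k arbitrary: \<psi>)
  case (Suc k)
  define P where "P a d = (\<Sum>e\<in>words {-1, 0, 1} k. q ^ nz e * (\<Sum>u\<in>words {0, 1} k. \<psi> (a # u) ((2 * of_int d + tval e) / 3)))" for a d
  have IH: "(\<Sum>u\<in>words {0, 1} k. \<Sum>v\<in>words {0, 1} k.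
        q ^ ham u v * \<psi> (a # u) ((2 * of_int d + tval u - tval v) / 3)) \<le> P a d" for d a
    unfolding P_def using Suc.IH[of "\<lambda>u x. \<psi> (a # u) ((2 * of_int d + x) / 3)"] Suc.prems
    by (simp add: add_diff_eq)
  have pos: "0 \<le> P a d" for a d
    unfolding P_def using Suc.prems assms(2) by (intro sum_nonneg mult_nonneg_nonneg) auto
  have "(\<Sum>u\<in>words {0, 1} (Suc k). \<Sum>v\<in>words {0, 1} (Suc k). q ^ ham u v * \<psi> u (tval u - tval v))
    = (\<Sum>a\<in>{0,1}. \<Sum>b\<in>{0,1}. \<Sum>u\<in>words {0, 1} k. \<Sum>v\<in>words {0, 1} k.
        q ^ ham (a # u) (b # v) * \<psi> (a # u) (tval (a # u) - tval (b # v)))"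
    unfolding sum_words_Suc by (intro sum.cong refl sum.swap)
  also have "\<dots> = (\<Sum>a\<in>{0,1}. \<Sum>b\<in>{0,1}. (if a = b then 1 else q) *
      (\<Sum>u\<in>words {0, 1} k. \<Sum>v\<in>words {0, 1} k.
        q ^ ham u v * \<psi> (a # u) ((2 * of_int (a - b) + tval u - tval v) / 3)))"
    unfolding sum_distrib_left
    by (intro sum.cong refl) (auto simp: algebra_simps diff_divide_distrib add_divide_distrib)
  also have "\<dots> \<le> (\<Sum>a\<in>{0,1}. \<Sum>b\<in>{0,1}. (if a = b then 1 else q) * P a (a - b))"
    using assms(2) by (intro sum_mono mult_left_mono IH) auto
  also have "\<dots> = P 0 0 + P 1 0 + q * P 0 (-1) + q * P 1 1"
    by (simp add: algebra_simps)
  \<comment> \<open>The two terms added, \<open>P 1 (-1)\<close> and \<open>P 0 1\<close>, would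
    require the second digit to be 2 or -1.\<close>
  also have "\<dots> \<le> P 0 0 + P 1 0 + q * (P 0 (-1) + P 1 (-1)) + q * (P 0 1 + P 1 1)"
    using mult_nonneg_nonneg[OF assms(2) pos[of 1 "-1"]] mult_nonneg_nonneg[OF assms(2) pos[of 0 1]]
    by (simp add: distrib_left)
  also have "\<dots> = (\<Sum>e\<in>words {-1, 0, 1} (Suc k). q ^ nz e * (\<Sum>u\<in>words {0, 1} (Suc k). \<psi> u (tval e)))"
    unfolding sum_words_Suc P_def by (simp add: algebra_simps sum.distrib sum_distrib_left)
  finally show ?case .
qed simp

lemma sum_power_nz:
  fixes q :: real
  shows "(\<Sum>e\<in>words {-1, 0, 1} k. q ^ nz e) = (1 + 2 * q) ^ k"
  by (induction k) (simp_all add: sum_words_Suc sum_distrib_left[symmetric] algebra_simps)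

section \<open>The energy of a family of scaled copies\<close>

text \<open>The point of \<open>scaled_copy r c\<close> with finite address \<open>u\<close>;
  subtracting 1/2 centres the Cantor set.\<close>

definition copy_point :: "real \<Rightarrow> real \<Rightarrow> int list \<Rightarrow> real" where
  "copy_point r c u = c + r * (tval u - 1 / 2)"

lemma copy_point_append:
  "copy_point r c (u @ v) = copy_point r c u + r * tval v / 3 ^ length u"
  by (simp add: copy_point_def tval_append algebra_simps)

text \<open>With \<open>X\<close> the gap of the prefixes times \<open>3 ^ m\<close>, closeness
  bounds \<open>X + (r * tval s - r' * tval t)\<close> by \<open>4 / 3 ^ L\<close>. The window terms
  lie between 0 and 2, so \<open>X\<close> is at most 4/3 + 2 in modulus, and the prefixes inherit
  the tolerance 4. Replacing \<open>r\<close> by \<open>r'\<close> in the window costs a further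
  \<open>1 / 3 ^ L\<close>, which turns 4 into 5.\<close>

lemma copy_point_window:
  assumes u: "u \<in> words {0, 1} m" "v \<in> words {0, 1} m"
    and s: "s \<in> words {0, 1} L" "t \<in> words {0, 1} L"
    and r: "1 \<le> r" "r \<le> 2" "1 \<le> r'" "r' \<le> 2" "\<bar>r - r'\<bar> \<le> 1 / 3 ^ L"
    and L: "0 < L"
    and close: "\<bar>copy_point r c (u @ s) - copy_point r' c' (v @ t)\<bar> \<le> 4 / 3 ^ (m + L)"
  shows "\<bar>copy_point r c u - copy_point r' c' v\<bar> \<le> 4 / 3 ^ m"
    and "\<bar>3 ^ m * (copy_point r c u - copy_point r' c' v) / r' + (tval s - tval t)\<bar> \<le> 5 / 3 ^ L"
proof -
  define X where "X = 3 ^ m * (copy_point r c u - copy_point r' c' v)"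
  have len: "length u = m" "length v = m" using u by (auto simp: words_def)
  have "copy_point r c (u @ s) - copy_point r' c' (v @ t) = (X + (r * tval s - r' * tval t)) / 3 ^ m"
    by (simp add: X_def copy_point_append len field_simps)
  then have "\<bar>X + (r * tval s - r' * tval t)\<bar> / 3 ^ m \<le> 4 / 3 ^ (m + L)"
    using close by simp
  then have X: "\<bar>X + (r * tval s - r' * tval t)\<bar> \<le> 4 / 3 ^ L"
    by (simp add: power_add field_simps)
  have pos: "0 \<le> r * tval s" "0 \<le> r' * tval t" "r * tval s \<le> 2" "r' * tval t \<le> 2"
    using tval_bounds[OF s(1)] tval_bounds[OF s(2)] r mult_mono[of r 2 "tval s" 1]
      mult_mono[of r' 2 "tval t" 1] by auto
  have "(3::real) ^ 1 \<le> 3 ^ L" using L by (intro power_increasing) auto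
  then have "4 / (3::real) ^ L \<le> 4 / 3" by (intro divide_left_mono) auto
  with X pos have "\<bar>X\<bar> \<le> 4" by linarith
  then have "\<bar>X / 3 ^ m\<bar> \<le> 4 / 3 ^ m"
    by (simp add: divide_right_mono)
  then show "\<bar>copy_point r c u - copy_point r' c' v\<bar> \<le> 4 / 3 ^ m"
    by (simp add: X_def)
  have "\<bar>(r' - r) * tval s\<bar> \<le> 1 / 3 ^ L"
    using tval_bounds[OF s(1)] r mult_mono[of "\<bar>r' - r\<bar>" "1 / 3 ^ L" "tval s" 1]
    by (simp add: abs_mult abs_minus_commute)
  moreover have "X + r' * (tval s - tval t) = (X + (r * tval s - r' * tval t)) + (r' - r) * tval s"
    by (simp add: algebra_simps)
  ultimately have *: "\<bar>X + r' * (tval s - tval t)\<bar> \<le> 5 / 3 ^ L"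
    using X by linarith
  have "X / r' + (tval s - tval t) = (X + r' * (tval s - tval t)) / r'"
    using r by (simp add: field_simps)
  also have "\<bar>\<dots>\<bar> \<le> \<bar>X + r' * (tval s - tval t)\<bar>"
    using r mult_left_mono[of 1 r' "\<bar>X + r' * (tval s - tval t)\<bar>"] by (simp add: field_simps)
  also note *
  finally show "\<bar>3 ^ m * (copy_point r c u - copy_point r' c' v) / r' + (tval s - tval t)\<bar> \<le> 5 / 3 ^ L"
    by (simp add: X_def)
qed

text \<open>Induction over windows of \<open>L\<close> digits. For a fixed pair of prefixes the new
  digits can realise at most the 6 difference words allowed by \<open>card_words_near\<close>, each
  of total weight \<open>2 ^ L\<close>. Division by \<open>2 ^ h\<close> then bounds the number of
  close pairs with at least \<open>h\<close> differing digits.\<close>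

lemma sum_pairs_high:
  assumes r: "1 \<le> r" "r \<le> 2" "1 \<le> r'" "r' \<le> 2" "\<bar>r - r'\<bar> \<le> 1 / 3 ^ L" and L: "0 < L"
  shows "(\<Sum>u\<in>words {0, 1} (n * L). \<Sum>v\<in>words {0, 1} (n * L).
      2 ^ ham u v * of_bool (\<bar>copy_point r c u - copy_point r' c' v\<bar> \<le> 4 / 3 ^ (n * L)))
    \<le> (6 * 2 ^ L :: real) ^ n"
proof (induction n)
  case 0
  have "card ({[]} \<inter> X) \<le> Suc 0" for X :: "int list set"
    using card_mono[of "{[]}" "{[]} \<inter> X"] by simp
  then show ?case by simp
next
  case (Suc n)
  let ?W = "words {0, 1} (n * L)" and ?V = "words {0, 1} L"
  define z where "z u v = 3 ^ (n * L) * (copy_point r c u - copy_point r' c' v) / r'" for u v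
  define N where "N u v = (2 ^ ham u v *
    of_bool (\<bar>copy_point r c u - copy_point r' c' v\<bar> \<le> 4 / 3 ^ (n * L)) :: real)" for u v
  have window: "(\<Sum>s\<in>?V. \<Sum>t\<in>?V. 2 ^ ham s t * of_bool (\<bar>z + (tval s - tval t)\<bar> \<le> 5 / 3 ^ L))
    \<le> (6 * 2 ^ L :: real)" for z
  proof -
    have "(\<Sum>s\<in>?V. \<Sum>t\<in>?V. 2 ^ ham s t * of_bool (\<bar>z + (tval s - tval t)\<bar> \<le> 5 / 3 ^ L))
      = 2 ^ L * (\<Sum>e\<in>words {-1, 0, 1} L. of_bool (\<bar>z + tval e\<bar> \<le> 5 / 3 ^ L) :: real)"
      by (rule sum_pairs_by_difference[where \<phi> = "\<lambda>x. of_bool (\<bar>z + x\<bar> \<le> 5 / 3 ^ L)"])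
    also have "(\<Sum>e\<in>words {-1, 0, 1} L. of_bool (\<bar>z + tval e\<bar> \<le> 5 / 3 ^ L) :: real)
      = card {e \<in> words {-1, 0, 1} L. \<bar>z + tval e\<bar> \<le> 5 / 3 ^ L}"
      by (subst sum_of_bool_eq) (auto simp: Int_def)
    also have "2 ^ L * \<dots> \<le> 2 ^ L * (5 + 1)"
      by (intro mult_left_mono card_words_near) auto
    finally show ?thesis by simp
  qed
  have "(\<Sum>u\<in>words {0, 1} (Suc n * L). \<Sum>v\<in>words {0, 1} (Suc n * L).
      2 ^ ham u v * of_bool (\<bar>copy_point r c u - copy_point r' c' v\<bar> \<le> 4 / 3 ^ (Suc n * L)))
    = (\<Sum>u\<in>?W. \<Sum>v\<in>?W. \<Sum>s\<in>?V. \<Sum>t\<in>?V. 2 ^ ham (u @ s) (v @ t) *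
        of_bool (\<bar>copy_point r c (u @ s) - copy_point r' c' (v @ t)\<bar> \<le> 4 / 3 ^ (n * L + L)) :: real)"
    unfolding mult_Suc add.commute[of L] sum_words_append by (intro sum.cong refl sum.swap)
  also have "\<dots> \<le> (\<Sum>u\<in>?W. \<Sum>v\<in>?W. \<Sum>s\<in>?V. \<Sum>t\<in>?V.
      N u v * (2 ^ ham s t * of_bool (\<bar>z u v + (tval s - tval t)\<bar> \<le> 5 / 3 ^ L)))"
  proof (intro sum_mono)
    fix u v s t assume uv: "u \<in> ?W" "v \<in> ?W" "s \<in> ?V" "t \<in> ?V"
    have "ham (u @ s) (v @ t) = ham u v + ham s t"
      using uv by (intro ham_append) (auto simp: words_def)
    then show "2 ^ ham (u @ s) (v @ t) *
        of_bool (\<bar>copy_point r c (u @ s) - copy_point r' c' (v @ t)\<bar> \<le> 4 / 3 ^ (n * L + L))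
      \<le> N u v * (2 ^ ham s t * of_bool (\<bar>z u v + (tval s - tval t)\<bar> \<le> 5 / 3 ^ L))"
      using copy_point_window[OF uv r L, of c c']
      by (auto simp: N_def z_def power_add of_bool_def)
  qed
  also have "\<dots> = (\<Sum>u\<in>?W. \<Sum>v\<in>?W. N u v * (\<Sum>s\<in>?V. \<Sum>t\<in>?V.
      2 ^ ham s t * of_bool (\<bar>z u v + (tval s - tval t)\<bar> \<le> 5 / 3 ^ L)))"
    by (simp only: sum_distrib_left)
  also have "\<dots> \<le> (\<Sum>u\<in>?W. \<Sum>v\<in>?W. N u v * (6 * 2 ^ L))"
    by (intro sum_mono mult_left_mono window) (auto simp: N_def)
  also have "\<dots> = (\<Sum>u\<in>?W. \<Sum>v\<in>?W. N u v) * (6 * 2 ^ L)"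
    by (simp add: sum_distrib_right)
  also have "\<dots> \<le> (6 * 2 ^ L) ^ n * (6 * 2 ^ L)"
    using Suc.IH by (intro mult_right_mono) (auto simp: N_def)
  finally show ?case by (simp add: mult.commute)
qed

text \<open>The affine function takes values larger than its tolerance at the centre, so it is steep
  where it is small, which confines the word to few prefixes.\<close>

lemma card_words_affine:
  fixes d \<sigma> :: real
  assumes d: "5 / 3 ^ m < \<bar>d\<bar>"
  shows "real (card {u \<in> words {0, 1} (2 * m). \<bar>d + \<sigma> * (tval u - 1 / 2)\<bar> \<le> 4 / 3 ^ (2 * m)})
    \<le> 4 * 2 ^ m" (is "real (card ?S) \<le> _")
proof (cases "?S = {}")
  case False
  \<comment> \<open>The affine function vanishes where \<open>tval u\<close> equals
    \<open>1 / 2 - d / \<sigma>\<close>. Of the distance \<open>3 / 3 ^ m\<close>, two parts come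
    from the tolerance divided by the slope and one from cutting off the last \<open>m\<close>
    digits.\<close>
  let ?P = "{w \<in> words {0, 1} m. \<bar>- (1 / 2 - d / \<sigma>) + tval w\<bar> \<le> 3 / 3 ^ m}"
  have p: "4 / (3::real) ^ (2 * m) = 4 / 3 ^ m * (1 / 3 ^ m)"
    by (simp add: mult_2 power_add)
  have le1: "4 / (3::real) ^ (2 * m) \<le> 4 / 3 ^ m"
    by (intro divide_left_mono power_increasing) auto
  have \<sigma>: "2 / 3 ^ m \<le> \<bar>\<sigma>\<bar>"
  proof -
    from False obtain u where u: "u \<in> words {0, 1} (2 * m)"
      "\<bar>d + \<sigma> * (tval u - 1 / 2)\<bar> \<le> 4 / 3 ^ (2 * m)" by auto
    have "\<bar>tval u - 1 / 2\<bar> \<le> 1 / 2"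
      using tval_bounds[OF u(1)] by linarith
    then have "\<bar>\<sigma> * (tval u - 1 / 2)\<bar> \<le> \<bar>\<sigma>\<bar> * (1 / 2)"
      unfolding abs_mult by (intro mult_left_mono) auto
    then have "5 / 3 ^ m - 4 / 3 ^ m \<le> \<bar>\<sigma>\<bar> * (1 / 2)"
      using u(2) d le1 by linarith
    moreover have "5 / (3::real) ^ m - 4 / 3 ^ m = (2 / 3 ^ m) * (1 / 2)"
      by (simp add: field_simps)
    ultimately show ?thesis by linarith
  qed
  then have \<sigma>0: "\<sigma> \<noteq> 0"
    using less_le_trans[of 0 "2 / 3 ^ m" "\<bar>\<sigma>\<bar>"] by auto
  have "?S \<subseteq> (\<lambda>(u, v). u @ v) ` (?P \<times> words {0, 1} m)"
  proof
    fix w assume w: "w \<in> ?S"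
    then have "w \<in> words {0, 1} (m + m)" by (simp add: mult_2)
    then obtain u v where uv: "w = u @ v" "u \<in> words {0, 1} m" "v \<in> words {0, 1} m"
      unfolding words_append by auto
    have "\<bar>\<sigma>\<bar> * \<bar>- (1 / 2 - d / \<sigma>) + tval w\<bar> = \<bar>d + \<sigma> * (tval w - 1 / 2)\<bar>"
      unfolding abs_mult[symmetric] using \<sigma>0 by (simp add: algebra_simps)
    also have "\<dots> \<le> 4 / 3 ^ m * (1 / 3 ^ m)"
      using w p by simp
    also have "\<dots> = 2 / 3 ^ m * (2 / 3 ^ m)"
      by simp
    also have "\<dots> \<le> \<bar>\<sigma>\<bar> * (2 / 3 ^ m)"
      using \<sigma> by (intro mult_right_mono) auto
    finally have "\<bar>- (1 / 2 - d / \<sigma>) + tval w\<bar> \<le> 2 / 3 ^ m"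
      by (rule mult_left_le_imp_le) (use \<sigma>0 in simp)
    moreover have "tval w = tval u + tval v / 3 ^ m"
      using uv by (simp add: tval_append words_def)
    moreover have "0 \<le> tval v / 3 ^ m" "tval v / 3 ^ m \<le> 1 / 3 ^ m"
      using tval_bounds[OF uv(3)] by (auto intro: divide_right_mono)
    moreover have "3 / (3::real) ^ m = 2 / 3 ^ m + 1 / 3 ^ m"
      by (simp add: field_simps)
    ultimately have "\<bar>- (1 / 2 - d / \<sigma>) + tval u\<bar> \<le> 3 / 3 ^ m"
      by linarith
    then show "w \<in> (\<lambda>(u, v). u @ v) ` (?P \<times> words {0, 1} m)"
      using uv by auto
  qed
  then have "card ?S \<le> card ((\<lambda>(u, v). u @ v) ` (?P \<times> words {0, 1} m))"
    by (intro card_mono) auto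
  also have "\<dots> \<le> card (?P \<times> words {0, 1} m)"
    by (intro card_image_le) auto
  finally have "card ?S \<le> card ?P * 2 ^ m"
    by (simp add: card_cartesian_product card_words flip: numeral_2_eq_2)
  then have "real (card ?S) \<le> real (card ?P * 2 ^ m)"
    by (rule of_nat_mono)
  also have "\<dots> = real (card ?P) * 2 ^ m"
    by simp
  also have "\<dots> \<le> (3 + 1) * 2 ^ m"
    by (intro mult_right_mono card_words_near) auto
  finally show ?thesis by simp
next
  case True
  then show ?thesis by (simp only: True card.empty) simp
qed

text \<open>Centres within \<open>5 / 3 ^ m\<close> of \<open>z\<close> carry little weight by the
  Frostman hypothesis, so all words may be allowed for them. For the other centres
  \<open>card_words_affine\<close> leaves at most a fraction \<open>4 * (1 / 2) ^ m\<close> of the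
  words, which \<open>1 / 2 \<le> x\<close> absorbs into \<open>4 * x ^ m\<close>.\<close>

lemma sum_affine_le:
  fixes p \<sigma> :: "real \<Rightarrow> real"
  assumes F: "finite F" "\<And>c. c \<in> F \<Longrightarrow> 0 \<le> p c" "sum p F \<le> 1"
    and frostman: "(\<Sum>c\<in>{c \<in> F. \<bar>c - z\<bar> \<le> 5 / 3 ^ m}. p c) \<le> A * x ^ m"
    and x: "1 / 2 \<le> x"
  shows "(\<Sum>c\<in>F. p c * (\<Sum>u\<in>words {0, 1} (2 * m).
      of_bool (\<bar>c - z + \<sigma> c * (tval u - 1 / 2)\<bar> \<le> 4 / 3 ^ (2 * m))))
    \<le> 2 ^ (2 * m) * ((A + 4) * x ^ m)"
proof -
  let ?near = "{c \<in> F. \<bar>c - z\<bar> \<le> 5 / 3 ^ m}"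
  define N where "N c = (\<Sum>u\<in>words {0, 1} (2 * m).
      of_bool (\<bar>c - z + \<sigma> c * (tval u - 1 / 2)\<bar> \<le> 4 / 3 ^ (2 * m)) :: real)" for c
  have N: "N c = real (card {u \<in> words {0, 1} (2 * m).
      \<bar>c - z + \<sigma> c * (tval u - 1 / 2)\<bar> \<le> 4 / 3 ^ (2 * m)})" for c
    unfolding N_def by (subst sum_of_bool_eq) (auto simp: Int_def)
  have N1: "N c \<le> 2 ^ (2 * m)" for c
  proof -
    have "N c \<le> (\<Sum>u\<in>words {0, 1} (2 * m). 1)"
      unfolding N_def by (intro sum_mono) auto
    then show ?thesis by (simp add: card_words)
  qed
  have "(\<Sum>c\<in>F. p c * N c) = (\<Sum>c\<in>?near. p c * N c) + (\<Sum>c\<in>F - ?near. p c * N c)"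
    using F(1) by (subst sum.subset_diff[of ?near]) (auto simp: add.commute)
  also have "(\<Sum>c\<in>?near. p c * N c) \<le> (\<Sum>c\<in>?near. p c * 2 ^ (2 * m))"
    using F(2) N1 by (intro sum_mono mult_left_mono) auto
  also have "\<dots> \<le> 2 ^ (2 * m) * (A * x ^ m)"
    unfolding sum_distrib_right[symmetric] using frostman by (simp add: mult.commute)
  also have "(\<Sum>c\<in>F - ?near. p c * N c) \<le> (\<Sum>c\<in>F - ?near. p c * (4 * 2 ^ m))"
  proof (intro sum_mono mult_left_mono)
    fix c assume c: "c \<in> F - ?near"
    then show "N c \<le> 4 * 2 ^ m"
      unfolding N by (intro card_words_affine) auto
    show "0 \<le> p c" using c F(2) by auto
  qed
  also have "\<dots> \<le> 1 * (4 * 2 ^ m)"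
    unfolding sum_distrib_right[symmetric] using F
    by (intro mult_right_mono order.trans[OF sum_mono2[OF F(1), of "F - ?near" p]]) auto
  also have "1 * (4 * 2 ^ m) = 2 ^ (2 * m) * (4 * (1 / 2) ^ m :: real)"
    by (simp add: mult_2 power_add power_one_over)
  also have "\<dots> \<le> 2 ^ (2 * m) * (4 * x ^ m)"
    using x by (intro mult_left_mono power_mono) auto
  finally show ?thesis
    unfolding N_def by (simp add: algebra_simps)
qed

text \<open>Pairs of words are cut at \<open>3 * n\<close> differing digits, three per window of
  \<open>2 * l\<close> digits. For many differences, \<open>sum_pairs_high\<close> divided by
  \<open>2 ^ (3 * n)\<close> gives the rate 6/8 per window. For few, the weighted count of
  difference words is \<open>(1 + 2 * q) ^ (2 * l)\<close> per window, the cut costs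
  \<open>q ^ 3\<close>, and averaging over \<open>c\<close> gains \<open>x ^ l\<close>. The common
  factor \<open>2 ^ (n * (2 * l))\<close> is the contribution of the pairs \<open>u = v\<close>
  within one copy.\<close>

lemma energy_bound:
  fixes p r :: "real \<Rightarrow> real"
  assumes F: "finite F" "\<And>c. c \<in> F \<Longrightarrow> 0 \<le> p c" "sum p F \<le> 1"
    and r: "\<And>c. c \<in> F \<Longrightarrow> 1 \<le> r c \<and> r c \<le> 1 + 1 / 3 ^ (2 * l)"
    and l: "0 < l"
    and frostman: "\<And>z. (\<Sum>c\<in>{c \<in> F. \<bar>c - z\<bar> \<le> 5 / 3 ^ (n * l)}. p c) \<le> A * x ^ (n * l)"
    and x: "1 / 2 \<le> x" and q: "0 < q" "q \<le> 1"
  shows "(\<Sum>c\<in>F. \<Sum>c'\<in>F. p c * p c' *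
      (\<Sum>u\<in>words {0, 1} (n * (2 * l)). \<Sum>v\<in>words {0, 1} (n * (2 * l)).
        of_bool (\<bar>copy_point (r c) c u - copy_point (r c') c' v\<bar> \<le> 4 / 3 ^ (n * (2 * l)))))
    \<le> 2 ^ (n * (2 * l)) * ((3 / 4) ^ n + (A + 4) * ((1 + 2 * q) ^ (2 * l) * x ^ l / q ^ 3) ^ n)"
proof -
  define k where "k = n * (2 * l)"
  have k2: "k = 2 * (n * l)" by (simp add: k_def)
  let ?W = "words {0, 1} k"
  define B where "B c c' u v = (of_bool (\<bar>copy_point (r c) c u - copy_point (r c') c' v\<bar> \<le> 4 / 3 ^ k) :: real)"
    for c c' u v
  have B0: "0 \<le> B c c' u v" for c c' u v by (simp add: B_def)
  define H where "H c c' = (\<Sum>u\<in>?W. \<Sum>v\<in>?W. 2 ^ ham u v * B c c' u v)" for c c'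
  define G where "G c c' = (\<Sum>u\<in>?W. \<Sum>v\<in>?W. q ^ ham u v * B c c' u v)" for c c'
  have split: "(\<Sum>u\<in>?W. \<Sum>v\<in>?W. B c c' u v) \<le> H c c' / 2 ^ (3 * n) + G c c' / q ^ (3 * n)" for c c'
  proof -
    \<comment> \<open>The first quotient is at least 1 from \<open>3 * n\<close> on, the second
      below, because \<open>q\<close> is at most 1.\<close>
    have "1 \<le> 2 ^ h / 2 ^ (3 * n) + q ^ h / q ^ (3 * n)" for h
    proof (cases "3 * n \<le> h")
      case True
      then have "(2::real) ^ (3 * n) \<le> 2 ^ h" by (intro power_increasing) auto
      then have "1 \<le> 2 ^ h / (2 ^ (3 * n) :: real)" by (simp add: field_simps)
      then show ?thesis using q by (intro order.trans[OF _ le_add_same_cancel1[THEN iffD2]]) auto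
    next
      case False
      then have "q ^ (3 * n) \<le> q ^ h" using q by (intro power_decreasing) auto
      then have "1 \<le> q ^ h / q ^ (3 * n)" using q by (simp add: field_simps)
      then show ?thesis by (intro order.trans[OF _ le_add_same_cancel2[THEN iffD2]]) auto
    qed
    then have "B c c' u v \<le> (2 ^ ham u v * B c c' u v) / 2 ^ (3 * n) + (q ^ ham u v * B c c' u v) / q ^ (3 * n)" for u v
      using mult_right_mono[OF _ B0, of 1 "2 ^ ham u v / 2 ^ (3 * n) + q ^ ham u v / q ^ (3 * n)"]
      by (simp add: algebra_simps)
    then show ?thesis
      unfolding H_def G_def sum_divide_distrib sum.distrib[symmetric] by (intro sum_mono)
  qed
  have H: "H c c' \<le> (6 * 2 ^ (2 * l)) ^ n" if "c \<in> F" "c' \<in> F" for c c'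
  proof -
    have "1 / (3::real) ^ (2 * l) \<le> 1" by simp
    then have "r c \<le> 2" "r c' \<le> 2" "\<bar>r c - r c'\<bar> \<le> 1 / 3 ^ (2 * l)"
      using r[OF that(1)] r[OF that(2)] by linarith+
    then show ?thesis
      unfolding H_def B_def k_def using r[OF that(1)] r[OF that(2)] l
      by (intro sum_pairs_high) auto
  qed
  have G: "(\<Sum>c\<in>F. p c * G c c') \<le> (1 + 2 * q) ^ k * (2 ^ k * ((A + 4) * x ^ (n * l)))"
    if c': "c' \<in> F" for c'
  proof -
    define \<psi> where "\<psi> c u y = (of_bool (\<bar>c - (c' - r c' * y) + (r c - r c') * (tval u - 1 / 2)\<bar> \<le> 4 / 3 ^ k) :: real)"
      for c u y
    have "G c c' \<le> (\<Sum>e\<in>words {-1, 0, 1} k. q ^ nz e * (\<Sum>u\<in>?W. \<psi> c u (tval e)))" for c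
    proof -
      \<comment> \<open>Fixing the difference word fixes \<open>tval u - tval v\<close>; what
        remains is affine in \<open>tval u\<close> with slope \<open>r c - r c'\<close>, as in
        \<open>sum_affine_le\<close>. Only \<open>c\<close> is averaged, while \<open>c'\<close>
        stays fixed.\<close>
      have "copy_point (r c) c u - copy_point (r c') c' v
        = c - (c' - r c' * (tval u - tval v)) + (r c - r c') * (tval u - 1 / 2)" for u v
        by (simp add: copy_point_def algebra_simps diff_divide_distrib)
      then have "G c c' = (\<Sum>u\<in>?W. \<Sum>v\<in>?W. q ^ ham u v * \<psi> c u (tval u - tval v))"
        unfolding G_def B_def \<psi>_def by (simp only:)
      also have "\<dots> \<le> (\<Sum>e\<in>words {-1, 0, 1} k. q ^ nz e * (\<Sum>u\<in>?W. \<psi> c u (tval e)))"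
        using q by (intro sum_pairs_le_by_difference) (auto simp: \<psi>_def)
      finally show ?thesis .
    qed
    then have "(\<Sum>c\<in>F. p c * G c c')
      \<le> (\<Sum>c\<in>F. p c * (\<Sum>e\<in>words {-1, 0, 1} k. q ^ nz e * (\<Sum>u\<in>?W. \<psi> c u (tval e))))"
      using F(2) by (intro sum_mono mult_left_mono) auto
    also have "\<dots> = (\<Sum>c\<in>F. \<Sum>e\<in>words {-1, 0, 1} k. q ^ nz e * (p c * (\<Sum>u\<in>?W. \<psi> c u (tval e))))"
      unfolding sum_distrib_left[of "p _" _ "words {-1, 0, 1} k"] by (simp only: mult.left_commute)
    also have "\<dots> = (\<Sum>e\<in>words {-1, 0, 1} k. q ^ nz e * (\<Sum>c\<in>F. p c * (\<Sum>u\<in>?W. \<psi> c u (tval e))))"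
      by (subst sum.swap) (simp only: sum_distrib_left)
    also have "\<dots> \<le> (\<Sum>e\<in>words {-1, 0, 1} k. q ^ nz e * (2 ^ k * ((A + 4) * x ^ (n * l))))"
      unfolding \<psi>_def k2 using q F x frostman
      by (intro sum_mono mult_left_mono sum_affine_le) auto
    also have "\<dots> = (1 + 2 * q) ^ k * (2 ^ k * ((A + 4) * x ^ (n * l)))"
      unfolding sum_distrib_right[symmetric] sum_power_nz ..
    finally show ?thesis .
  qed
  have A0: "0 \<le> A * x ^ (n * l)"
  proof -
    have "0 \<le> (\<Sum>c\<in>{c \<in> F. \<bar>c - 0\<bar> \<le> 5 / 3 ^ (n * l)}. p c)"
      using F(2) by (intro sum_nonneg) auto
    then show ?thesis using frostman[of 0] by linarith
  qed
  then have A4: "0 \<le> (A + 4) * x ^ (n * l)"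
    using x by (simp add: distrib_right)
  have "(\<Sum>c\<in>F. \<Sum>c'\<in>F. p c * p c' * (\<Sum>u\<in>?W. \<Sum>v\<in>?W. B c c' u v))
    \<le> (\<Sum>c\<in>F. \<Sum>c'\<in>F. p c * p c' * ((6 * 2 ^ (2 * l)) ^ n / 2 ^ (3 * n) + G c c' / q ^ (3 * n)))"
    using F(2) H by (intro sum_mono mult_left_mono order.trans[OF split] add_right_mono divide_right_mono) auto
  also have "\<dots> = (\<Sum>c\<in>F. p c) * (\<Sum>c\<in>F. p c) * ((6 * 2 ^ (2 * l)) ^ n / 2 ^ (3 * n))
      + (\<Sum>c'\<in>F. p c' * ((\<Sum>c\<in>F. p c * G c c') / q ^ (3 * n)))"
  proof -
    have "(\<Sum>c\<in>F. \<Sum>c'\<in>F. p c * p c' * (X + G c c' / q ^ (3 * n)))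
      = (\<Sum>c\<in>F. p c) * (\<Sum>c\<in>F. p c) * X + (\<Sum>c'\<in>F. p c' * ((\<Sum>c\<in>F. p c * G c c') / q ^ (3 * n)))" for X
    proof -
      have "(\<Sum>c\<in>F. \<Sum>c'\<in>F. p c * p c' * (G c c' / q ^ (3 * n)))
        = (\<Sum>c'\<in>F. p c' * ((\<Sum>c\<in>F. p c * G c c') / q ^ (3 * n)))"
        by (subst sum.swap) (simp add: sum_distrib_left sum_divide_distrib mult_ac)
      moreover have "(\<Sum>c\<in>F. \<Sum>c'\<in>F. p c * p c' * X) = (\<Sum>c\<in>F. p c) * (\<Sum>c\<in>F. p c) * X"
        unfolding sum_product unfolding sum_distrib_right ..
      ultimately show ?thesis
        by (simp only: distrib_left sum.distrib)
    qed
    then show ?thesis .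
  qed
  also have "\<dots> \<le> 1 * ((6 * 2 ^ (2 * l)) ^ n / 2 ^ (3 * n))
      + (\<Sum>c'\<in>F. p c' * ((1 + 2 * q) ^ k * (2 ^ k * ((A + 4) * x ^ (n * l))) / q ^ (3 * n)))"
    using F q G by (intro add_mono mult_right_mono sum_mono mult_left_mono divide_right_mono
        mult_le_one sum_nonneg) auto
  also have "\<dots> \<le> 1 * ((6 * 2 ^ (2 * l)) ^ n / 2 ^ (3 * n))
      + 1 * ((1 + 2 * q) ^ k * (2 ^ k * ((A + 4) * x ^ (n * l))) / q ^ (3 * n))"
    unfolding sum_distrib_right[symmetric] using F q A4
    by (intro add_mono mult_right_mono order.refl) auto
  also have "\<dots> = 2 ^ k * ((3 / 4) ^ n + (A + 4) * ((1 + 2 * q) ^ (2 * l) * x ^ l / q ^ 3) ^ n)"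
  proof -
    have "(6 * 2 ^ (2 * l)) ^ n / 2 ^ (3 * n) = (2 ^ k * (3 / 4) ^ n :: real)"
    proof -
      have "(6 * 2 ^ (2 * l)) ^ n / 2 ^ (3 * n) = ((6 * 2 ^ (2 * l)) / 2 ^ 3 :: real) ^ n"
        by (simp only: power_mult power_divide)
      also have "(6 * 2 ^ (2 * l)) / 2 ^ 3 = (2 ^ (2 * l) * (3 / 4) :: real)"
        by simp
      also have "\<dots> ^ n = 2 ^ k * (3 / 4) ^ n"
        by (simp only: power_mult_distrib k_def power_mult[symmetric] mult.commute)
      finally show ?thesis .
    qed
    moreover have "(1 + 2 * q) ^ k * x ^ (n * l) / q ^ (3 * n)
      = ((1 + 2 * q) ^ (2 * l) * x ^ l / q ^ 3) ^ n"
      by (simp add: power_mult_distrib power_divide k_def power_mult[symmetric] mult.commute)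
    moreover have "(1 + 2 * q) ^ k * (2 ^ k * ((A + 4) * x ^ (n * l))) / q ^ (3 * n)
      = 2 ^ k * (A + 4) * ((1 + 2 * q) ^ k * x ^ (n * l) / q ^ (3 * n))"
      by (simp add: mult_ac)
    ultimately show ?thesis by (simp only: distrib_left distrib_right mult_1 mult.assoc)
  qed
  finally show ?thesis unfolding B_def k_def .
qed

section \<open>Triadic net content\<close>

text \<open>The half-open triadic interval of length \<open>1 / 3 ^ fst z\<close> with left end
  \<open>snd z / 3 ^ fst z\<close>. Floors make every point lie in exactly one cell of each
  level.\<close>

definition cell :: "nat \<times> int \<Rightarrow> real set" where
  "cell z = {y. \<lfloor>3 ^ fst z * y\<rfloor> = snd z}"

text \<open>With \<open>x = 3 powr - s\<close>, a cell costs its length to the power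
  \<open>s\<close>. The cost of a cover is made a measure on cells so that countable additivity and
  continuity from below apply to covers.\<close>

definition net_weight :: "real \<Rightarrow> (nat \<times> int) measure" where
  "net_weight x = density (count_space UNIV) (\<lambda>z. ennreal (x ^ fst z))"

text \<open>Covers are sets of cells and hence countable. Cell lengths are bounded only by 1, so
  this is an analogue of Hausdorff content, without a limit over the mesh.\<close>

definition net_content :: "real \<Rightarrow> real set \<Rightarrow> ennreal" where
  "net_content x E = (INF S \<in> {S. E \<subseteq> \<Union> (cell ` S)}. emeasure (net_weight x) S)"

lemma sets_net_weight [simp]: "sets (net_weight x) = UNIV"
  by (simp add: net_weight_def)

lemma emeasure_net_weight:
  "emeasure (net_weight x) S = (\<integral>\<^sup>+z. ennreal (x ^ fst z) * indicator S z \<partial>count_space UNIV)"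
  by (simp add: net_weight_def emeasure_density)

lemma emeasure_net_weight_single [simp]: "emeasure (net_weight x) {z} = ennreal (x ^ fst z)"
  by (simp add: emeasure_net_weight nn_integral_count_space_indicator[symmetric]
      nn_integral_count_space_finite)

lemma mem_cells_iff: "y \<in> \<Union> (cell ` S) \<longleftrightarrow> (\<exists>k. (k, \<lfloor>3 ^ k * y\<rfloor>) \<in> S)"
  by (force simp: cell_def)

text \<open>Deleting the last \<open>k - j\<close> ternary digits of an index yields the index of
  the ancestor cell; nestedness of cells rests on this.\<close>

lemma floor_power_div:
  assumes "j \<le> k"
  shows "\<lfloor>3 ^ j * y\<rfloor> = \<lfloor>3 ^ k * y :: real\<rfloor> div 3 ^ (k - j)"
proof -
  have "(3::real) ^ k = 3 ^ j * 3 ^ (k - j)"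
    using assms by (simp flip: power_add)
  then have "3 ^ j * y = 3 ^ k * y / real_of_int (3 ^ (k - j))"
    by simp
  then show ?thesis
    using floor_divide_real_eq_div[of "3 ^ (k - j)" "3 ^ k * y"] by simp
qed

lemma cell_nested:
  assumes "j \<le> k" "y \<in> cell (j, p)" "y \<in> cell (k, q)"
  shows "cell (k, q) \<subseteq> cell (j, p)"
  using assms floor_power_div[OF assms(1)] by (auto simp: cell_def)

lemma net_content_le:
  "E \<subseteq> \<Union> (cell ` S) \<Longrightarrow> net_content x E \<le> emeasure (net_weight x) S"
  unfolding net_content_def by (rule INF_lower) simp

lemma net_content_less:
  assumes "net_content x E < b"
  obtains S where "E \<subseteq> \<Union> (cell ` S)" "emeasure (net_weight x) S < b"
  using assms unfolding net_content_def by (auto simp: INF_less_iff)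

lemma net_content_cell:
  "E \<subseteq> cell z \<Longrightarrow> net_content x E \<le> ennreal (x ^ fst z)"
  using net_content_le[of E "{z}" x] by simp

lemma net_content_empty [simp]: "net_content x {} = 0"
  using net_content_le[of "{}" "{}" x] by simp

lemma net_content_UN:
  fixes E :: "nat \<Rightarrow> real set"
  shows "net_content x (\<Union>i. E i) \<le> (\<Sum>i. net_content x (E i))"
proof (rule ennreal_le_epsilon)
  fix e :: real assume fin: "(\<Sum>i. net_content x (E i)) < top" and e: "0 < e"
  define \<epsilon> where "\<epsilon> i = ennreal (e * (1 / 2) ^ Suc i)" for i
  have "\<exists>S. E i \<subseteq> \<Union> (cell ` S) \<and> emeasure (net_weight x) S < net_content x (E i) + \<epsilon> i" for i
  proof -
    have "net_content x (E i) < top"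
      using fin ennreal_suminf_lessD by blast
    then have "net_content x (E i) < net_content x (E i) + \<epsilon> i"
      using e ennreal_add_left_cancel_less[of "net_content x (E i)" 0 "\<epsilon> i"]
      by (simp add: \<epsilon>_def)
    then show ?thesis by (elim net_content_less) blast
  qed
  then obtain S where S: "\<And>i. E i \<subseteq> \<Union> (cell ` S i)"
    "\<And>i. emeasure (net_weight x) (S i) < net_content x (E i) + \<epsilon> i"
    by metis
  have "net_content x (\<Union>i. E i) \<le> emeasure (net_weight x) (\<Union>i. S i)"
    using S(1) by (intro net_content_le) blast
  also have "\<dots> \<le> (\<Sum>i. emeasure (net_weight x) (S i))"
    by (intro emeasure_subadditive_countably) auto
  also have "\<dots> \<le> (\<Sum>i. net_content x (E i) + \<epsilon> i)"
    using S(2) by (intro suminf_le summableI less_imp_le)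
  also have "\<dots> = (\<Sum>i. net_content x (E i)) + (\<Sum>i. \<epsilon> i)"
    by (intro suminf_add[symmetric] summableI)
  also have "(\<Sum>i. \<epsilon> i) = ennreal (e * 1)"
    unfolding \<epsilon>_def using e by (intro suminf_ennreal_eq sums_mult power_half_series) auto
  finally show "net_content x (\<Union>i. E i) \<le> (\<Sum>i. net_content x (E i)) + ennreal e" by simp
qed

lemma net_content_UN_finite:
  assumes "finite I"
  shows "net_content x (\<Union>i\<in>I. A i) \<le> (\<Sum>i\<in>I. net_content x (A i))"
  using assms
proof (induction I rule: finite_induct)
  case (insert i I)
  have "net_content x (A i \<union> (\<Union>i\<in>I. A i)) \<le> net_content x (A i) + net_content x (\<Union>i\<in>I. A i)"
    using net_content_UN[of x "binaryset (A i) (\<Union>i\<in>I. A i)"]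
    by (simp add: UN_binaryset_eq suminf_binaryset_eq)
  also have "\<dots> \<le> net_content x (A i) + (\<Sum>i\<in>I. net_content x (A i))"
    by (intro add_left_mono insert.IH)
  finally show ?case using insert.hyps by simp
qed simp

text \<open>The join keeps the maximal cells of both covers and the meet collects the cells it discards.
  Since the meet covers whatever both covers have in common, enlarging a nearly optimal cover of a set
  to a cover of a larger set by a join costs hardly more than the difference of the contents.\<close>

definition cover_join :: "(nat \<times> int) set \<Rightarrow> (nat \<times> int) set \<Rightarrow> (nat \<times> int) set" where
  "cover_join T S = {t \<in> T. \<not> (\<exists>s\<in>S. fst s < fst t \<and> cell t \<subseteq> cell s)}
    \<union> {s \<in> S. \<not> (\<exists>t\<in>T. fst t \<le> fst s \<and> cell s \<subseteq> cell t)}"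

definition cover_meet :: "(nat \<times> int) set \<Rightarrow> (nat \<times> int) set \<Rightarrow> (nat \<times> int) set" where
  "cover_meet T S = {t \<in> T. \<exists>s\<in>S. fst s < fst t \<and> cell t \<subseteq> cell s}
    \<union> {s \<in> S. \<exists>t\<in>T. fst t \<le> fst s \<and> cell s \<subseteq> cell t}"

text \<open>Each of \<open>T\<close> and \<open>S\<close> splits into the cells it keeps and those
  it discards, and the costs add up; the unions can only lose by overlapping. The weak inequality in
  the clause for \<open>S\<close> breaks ties: of a cell in both covers, the occurrence in
  \<open>S\<close> is discarded.\<close>

lemma cover_join_meet:
  "emeasure (net_weight x) (cover_join T S) + emeasure (net_weight x) (cover_meet T S)
    \<le> emeasure (net_weight x) T + emeasure (net_weight x) S"
proof -
  let ?\<kappa> = "emeasure (net_weight x)"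
  let ?T = "{t \<in> T. \<exists>s\<in>S. fst s < fst t \<and> cell t \<subseteq> cell s}"
  let ?S = "{s \<in> S. \<exists>t\<in>T. fst t \<le> fst s \<and> cell s \<subseteq> cell t}"
  have "?\<kappa> (cover_join T S) \<le> ?\<kappa> ((T - ?T) \<union> (S - ?S))"
    by (intro emeasure_mono) (auto simp: cover_join_def)
  also have "\<dots> \<le> ?\<kappa> (T - ?T) + ?\<kappa> (S - ?S)"
    by (intro emeasure_subadditive) auto
  finally have "?\<kappa> (cover_join T S) \<le> ?\<kappa> (T - ?T) + ?\<kappa> (S - ?S)" .
  moreover have "?\<kappa> (cover_meet T S) \<le> ?\<kappa> ?T + ?\<kappa> ?S"
    unfolding cover_meet_def by (intro emeasure_subadditive) auto
  ultimately have "?\<kappa> (cover_join T S) + ?\<kappa> (cover_meet T S)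
    \<le> (?\<kappa> (T - ?T) + ?\<kappa> (S - ?S)) + (?\<kappa> ?T + ?\<kappa> ?S)"
    by (rule add_mono)
  also have "\<dots> = (?\<kappa> ?T + ?\<kappa> (T - ?T)) + (?\<kappa> ?S + ?\<kappa> (S - ?S))"
    by (simp only: add_ac)
  also have "?\<kappa> ?T + ?\<kappa> (T - ?T) = ?\<kappa> (?T \<union> (T - ?T))"
    by (intro plus_emeasure) auto
  also have "?T \<union> (T - ?T) = T" by blast
  also have "?\<kappa> ?S + ?\<kappa> (S - ?S) = ?\<kappa> (?S \<union> (S - ?S))"
    by (intro plus_emeasure) auto
  also have "?S \<union> (S - ?S) = S" by blast
  finally show ?thesis .
qed

text \<open>Nothing lies above the largest cell around \<open>y\<close>, so at most a tie could
  discard it, and then it is kept as a cell of \<open>T\<close>. Hence joins lose no point and never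
  lower the size of the largest cell around a point.\<close>

lemma cover_join_least:
  fixes y :: real
  assumes "(k, \<lfloor>3 ^ k * y\<rfloor>) \<in> T \<union> S" and "\<And>j. (j, \<lfloor>3 ^ j * y\<rfloor>) \<in> T \<union> S \<Longrightarrow> k \<le> j"
  shows "(k, \<lfloor>3 ^ k * y\<rfloor>) \<in> cover_join T S"
proof -
  have above: "s = (fst s, \<lfloor>3 ^ fst s * y\<rfloor>)" if "cell (k, \<lfloor>3 ^ k * y\<rfloor>) \<subseteq> cell s" for s
  proof -
    have "y \<in> cell (k, \<lfloor>3 ^ k * y\<rfloor>)" by (simp add: cell_def)
    with that have "y \<in> cell s" by blast
    then show ?thesis by (cases s) (simp add: cell_def)
  qed
  show ?thesis
  proof (cases "(k, \<lfloor>3 ^ k * y\<rfloor>) \<in> T")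
    case True
    have "\<not> (fst s < k \<and> cell (k, \<lfloor>3 ^ k * y\<rfloor>) \<subseteq> cell s)" if "s \<in> S" for s
      using above[of s] assms(2)[of "fst s"] that by (metis Un_iff not_less)
    then show ?thesis
      using True by (auto simp: cover_join_def)
  next
    case False
    have "\<not> (fst t \<le> k \<and> cell (k, \<lfloor>3 ^ k * y\<rfloor>) \<subseteq> cell t)" if "t \<in> T" for t
      using above[of t] assms(2)[of "fst t"] that False by (metis Un_iff antisym)
    then show ?thesis
      using assms(1) False by (auto simp: cover_join_def)
  qed
qed

text \<open>Two cells through a common point are nested, and the inner one is discarded by the
  join.\<close>

lemma cover_meet_covers:
  "\<Union> (cell ` T) \<inter> \<Union> (cell ` S) \<subseteq> \<Union> (cell ` cover_meet T S)"
proof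
  fix y assume "y \<in> \<Union> (cell ` T) \<inter> \<Union> (cell ` S)"
  then obtain t s where ts: "t \<in> T" "s \<in> S" "y \<in> cell t" "y \<in> cell s" by auto
  show "y \<in> \<Union> (cell ` cover_meet T S)"
  proof (cases "fst s < fst t")
    case True
    then have "cell t \<subseteq> cell s"
      using ts cell_nested[of "fst s" "fst t" y "snd s" "snd t"] by simp
    then have "t \<in> cover_meet T S"
      using True ts by (auto simp: cover_meet_def)
    then show ?thesis using ts by blast
  next
    case False
    then have "cell s \<subseteq> cell t"
      using ts cell_nested[of "fst t" "fst s" y "snd t" "snd s"] by simp
    then have "s \<in> cover_meet T S"
      using False ts by (auto simp: cover_meet_def not_less)
    then show ?thesis using ts by blast
  qed
qed

text \<open>Successive joins \<open>T n\<close> of nearly optimal covers stay nearly optimal. Once a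
  point is covered, the level of the largest cell of \<open>T n\<close> around it can only decrease,
  hence stabilises; so the cells belonging to all late \<open>T n\<close> cover the union, and
  continuity of the cost from below gives the bound.\<close>

lemma net_content_incseq:
  assumes E: "incseq E" and b: "\<And>n. net_content x (E n) \<le> b"
  shows "net_content x (\<Union>n. E n) \<le> b"
proof (rule ennreal_le_epsilon)
  fix e :: real assume top: "b < top" and e: "0 < e"
  let ?\<kappa> = "emeasure (net_weight x)"
  define \<epsilon> where "\<epsilon> n = ennreal (e * (1 / 2) ^ Suc n)" for n
  have \<epsilon>_Suc: "\<epsilon> (Suc n) + \<epsilon> (Suc n) = \<epsilon> n" for n
    using e by (simp add: \<epsilon>_def flip: ennreal_plus)
  have \<epsilon>0: "\<epsilon> 0 + \<epsilon> 0 = ennreal e"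
    using e by (simp add: \<epsilon>_def flip: ennreal_plus)
  have fin: "net_content x (E n) < top" for n
    using b[of n] top by (rule le_less_trans)
  have "\<exists>S. E n \<subseteq> \<Union> (cell ` S) \<and> ?\<kappa> S \<le> net_content x (E n) + \<epsilon> n" for n
  proof -
    have "net_content x (E n) < net_content x (E n) + \<epsilon> n"
      using fin[of n] e ennreal_add_left_cancel_less[of "net_content x (E n)" 0 "\<epsilon> n"]
      by (simp add: \<epsilon>_def)
    then show ?thesis by (metis net_content_less less_imp_le)
  qed
  then obtain S where S: "\<And>n. E n \<subseteq> \<Union> (cell ` S n)"
    "\<And>n. ?\<kappa> (S n) \<le> net_content x (E n) + \<epsilon> n"
    by metis
  define T where "T = rec_nat (S 0) (\<lambda>n t. cover_join t (S (Suc n)))"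
  have T_0: "T 0 = S 0" and T_Suc: "T (Suc n) = cover_join (T n) (S (Suc n))" for n
    by (simp_all add: T_def)
  \<comment> \<open>The level of the largest cell of \<open>T n\<close> around \<open>y\<close>,
    meaningful for covered \<open>y\<close> only.\<close>
  define least where "least n y = (LEAST k. (k, \<lfloor>3 ^ k * y\<rfloor>) \<in> T n)" for n and y :: real
  have merge: "y \<in> \<Union> (cell ` T (Suc n)) \<and> (y \<in> \<Union> (cell ` T n) \<longrightarrow> least (Suc n) y \<le> least n y)"
    if y: "y \<in> \<Union> (cell ` (T n \<union> S (Suc n)))" for n y
  proof -
    define k where "k = (LEAST k. (k, \<lfloor>3 ^ k * y\<rfloor>) \<in> T n \<union> S (Suc n))"
    have k: "(k, \<lfloor>3 ^ k * y\<rfloor>) \<in> T n \<union> S (Suc n)"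
      using y LeastI_ex[of "\<lambda>k. (k, \<lfloor>3 ^ k * y\<rfloor>) \<in> T n \<union> S (Suc n)"]
      unfolding mem_cells_iff k_def by simp
    have kle: "k \<le> j" if "(j, \<lfloor>3 ^ j * y\<rfloor>) \<in> T n \<union> S (Suc n)" for j
      unfolding k_def using that by (rule Least_le)
    have kT: "(k, \<lfloor>3 ^ k * y\<rfloor>) \<in> T (Suc n)"
      using cover_join_least[OF k kle] by (simp add: T_Suc)
    moreover have "least (Suc n) y \<le> least n y" if "y \<in> \<Union> (cell ` T n)"
    proof -
      have "least (Suc n) y \<le> k"
        unfolding least_def using kT by (rule Least_le)
      also have "(least n y, \<lfloor>3 ^ least n y * y\<rfloor>) \<in> T n"
        using that unfolding mem_cells_iff least_def by (rule LeastI_ex)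
      then have "k \<le> least n y" by (intro kle) auto
      finally show ?thesis .
    qed
    ultimately show ?thesis unfolding mem_cells_iff by blast
  qed
  have cover: "E n \<subseteq> \<Union> (cell ` T n)" for n
  proof (cases n)
    case 0
    then show ?thesis using S(1)[of 0] by (simp add: T_0)
  next
    case (Suc m)
    have "y \<in> \<Union> (cell ` T n)" if "y \<in> E n" for y
      using merge[of y m] subsetD[OF S(1) that] by (simp add: Suc)
    then show ?thesis by blast
  qed
  \<comment> \<open>The extra \<open>\<epsilon> n\<close> on the left is a reserve for later joins:
    one step spends \<open>\<epsilon> (Suc n)\<close> on the slack of the new cover and keeps as
    much. Cancelling \<open>net_content x (E n)\<close> relies on its finiteness.\<close>
  have bound: "?\<kappa> (T n) + \<epsilon> n \<le> net_content x (E n) + ennreal e" for n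
  proof (induction n)
    case 0
    show ?case
      using add_right_mono[OF S(2)[of 0], of "\<epsilon> 0"] by (simp add: T_0 add.assoc \<epsilon>0)
  next
    case (Suc n)
    have "E n \<subseteq> \<Union> (cell ` cover_meet (T n) (S (Suc n)))"
      using cover[of n] S(1)[of "Suc n"] incseq_SucD[OF E, of n] cover_meet_covers by blast
    then have "net_content x (E n) \<le> ?\<kappa> (cover_meet (T n) (S (Suc n)))"
      by (rule net_content_le)
    then have "?\<kappa> (T (Suc n)) + net_content x (E n) \<le> ?\<kappa> (T n) + ?\<kappa> (S (Suc n))"
      unfolding T_Suc using cover_join_meet by (meson add_left_mono order.trans)
    also have "\<dots> \<le> ?\<kappa> (T n) + (net_content x (E (Suc n)) + \<epsilon> (Suc n))"
      by (intro add_left_mono S)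
    finally have "?\<kappa> (T (Suc n)) + net_content x (E n) + \<epsilon> (Suc n)
      \<le> ?\<kappa> (T n) + (net_content x (E (Suc n)) + \<epsilon> (Suc n)) + \<epsilon> (Suc n)"
      by (rule add_right_mono)
    also have "\<dots> = (?\<kappa> (T n) + \<epsilon> n) + net_content x (E (Suc n))"
      unfolding \<epsilon>_Suc[of n, symmetric] by (simp add: add_ac)
    also have "\<dots> \<le> (net_content x (E n) + ennreal e) + net_content x (E (Suc n))"
      by (intro add_right_mono Suc.IH)
    finally have "net_content x (E n) + (?\<kappa> (T (Suc n)) + \<epsilon> (Suc n))
      \<le> net_content x (E n) + (net_content x (E (Suc n)) + ennreal e)"
      by (simp add: add_ac)
    then show ?case
      using fin[of n] by (auto simp: ennreal_add_left_cancel_le)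
  qed
  define R where "R m = (\<Inter>n\<in>{m..}. T n)" for m
  have R: "incseq R"
    unfolding R_def by (intro incseq_SucI) force
  have "(\<Union>n. E n) \<subseteq> \<Union> (cell ` (\<Union>m. R m))"
  proof
    fix y assume "y \<in> (\<Union>n. E n)"
    then obtain N where N: "y \<in> E N" by auto
    have yT: "y \<in> \<Union> (cell ` T n)" if "N \<le> n" for n
      using cover[of n] N incseqD[OF E that] by blast
    \<comment> \<open>From the stage \<open>m\<close> where the level is minimal it is constant, so
      one and the same cell around \<open>y\<close> lies in every later \<open>T n\<close>.\<close>
    obtain m where m: "N \<le> m" "\<And>n. N \<le> n \<Longrightarrow> least m y \<le> least n y"
      using ex_has_least_nat[of "\<lambda>n. N \<le> n" N "\<lambda>n. least n y"] by auto
    have "least n y \<le> least m y" if "m \<le> n" for n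
      using that
    proof (induction n rule: dec_induct)
      case (step n)
      then show ?case
        using yT[of n] m(1) merge[of y n] by simp
    qed simp
    then have "least n y = least m y" if "m \<le> n" for n
      using m(2)[of n] order.trans[OF m(1) that] that by (simp add: antisym)
    moreover have "(least n y, \<lfloor>3 ^ least n y * y\<rfloor>) \<in> T n" if "N \<le> n" for n
      using yT[OF that] unfolding mem_cells_iff least_def by (rule LeastI_ex)
    ultimately have "(least m y, \<lfloor>3 ^ least m y * y\<rfloor>) \<in> T n" if "m \<le> n" for n
      using that m(1) order.trans[OF m(1) that] by metis
    then have "(least m y, \<lfloor>3 ^ least m y * y\<rfloor>) \<in> R m"
      unfolding R_def by blast
    then show "y \<in> \<Union> (cell ` (\<Union>m. R m))"
      unfolding mem_cells_iff by blast
  qed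
  then have "net_content x (\<Union>n. E n) \<le> ?\<kappa> (\<Union>m. R m)"
    by (rule net_content_le)
  also have "\<dots> = (SUP m. ?\<kappa> (R m))"
    using R by (intro SUP_emeasure_incseq[symmetric]) auto
  also have "\<dots> \<le> b + ennreal e"
  proof (rule SUP_least)
    fix m
    have "?\<kappa> (R m) \<le> ?\<kappa> (T m)"
      unfolding R_def by (intro emeasure_mono) auto
    also have "\<dots> \<le> ?\<kappa> (T m) + \<epsilon> m"
      by simp
    also note bound
    also have "net_content x (E m) + ennreal e \<le> b + ennreal e"
      by (intro add_right_mono b)
    finally show "?\<kappa> (R m) \<le> b + ennreal e" .
  qed
  finally show "net_content x (\<Union>n. E n) \<le> b + ennreal e" .
qed

section \<open>Hausdorff measure and the Cantor set\<close>

lemma diameter_cell: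
  shows "bounded (cell z)" and "diameter (cell z) \<le> 1 / 3 ^ fst z"
proof -
  have sub: "cell z \<subseteq> {of_int (snd z) / 3 ^ fst z .. (of_int (snd z) + 1) / 3 ^ fst z}"
    by (auto simp: cell_def floor_eq_iff field_simps less_imp_le)
  show "bounded (cell z)"
    by (rule bounded_subset[OF bounded_closed_interval sub])
  have "norm (y - y') \<le> 1 / 3 ^ fst z" if "y \<in> cell z" "y' \<in> cell z" for y y'
  proof -
    have "(of_int (snd z) + 1) / 3 ^ fst z = of_int (snd z) / 3 ^ fst z + 1 / (3::real) ^ fst z"
      by (simp add: add_divide_distrib)
    then show ?thesis
      using subsetD[OF sub that(1)] subsetD[OF sub that(2)] by (auto simp: abs_le_iff)
  qed
  then show "diameter (cell z) \<le> 1 / 3 ^ fst z"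
    by (intro diameter_le) auto
qed

text \<open>The mesh condition comes for free: a single cell of level at most \<open>k0\<close>
  already costs at least \<open>3 powr - s\<close> to the power \<open>k0\<close>, so a cheaper
  cover consists of deeper, and therefore small, cells.\<close>

lemma hausdorff_measure_net_null:
  assumes s: "0 < s" and null: "net_content (3 powr - s) E = 0"
  shows "hausdorff_measure s E = 0"
proof -
  let ?x = "3 powr - s" let ?\<kappa> = "emeasure (net_weight ?x)"
  have x: "0 < ?x" "?x < 1"
    using s powr_less_mono[of "- s" 0 3] by auto
  have "hausdorff_premeasure s d E \<le> 0 + ennreal e" if d: "0 < d" and e: "0 < e" for d e
  proof -
    obtain k0 where k0: "1 / 3 ^ k0 < d"
      using real_arch_pow_inv[OF d, of "1 / 3"] by (auto simp: power_one_over)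
    have "net_content ?x E < ennreal (min e (?x ^ k0))"
      using null e x by (simp add: min_def)
    then obtain S where S: "E \<subseteq> \<Union> (cell ` S)" "?\<kappa> S < ennreal (min e (?x ^ k0))"
      by (rule net_content_less)
    have deep: "k0 < fst z" if "z \<in> S" for z
    proof (rule ccontr)
      assume "\<not> k0 < fst z"
      then have "?x ^ k0 \<le> ?x ^ fst z" using x by (intro power_decreasing) auto
      also have "ennreal \<dots> \<le> ?\<kappa> S"
        using emeasure_mono[of "{z}" S "net_weight ?x"] that by simp
      finally have "ennreal (?x ^ k0) \<le> ?\<kappa> S" by (simp add: ennreal_leI)
      also note S(2)
      finally show False using x e by (simp add: ennreal_less_iff)
    qed
    \<comment> \<open>The cover is indexed by codes of its cells, other indices giving empty sets;
      the disjoint sets \<open>A i\<close> turn the sum of costs into the measure of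
      \<open>S\<close>.\<close>
    define A where "A i = (if i \<in> to_nat ` S then {from_nat i} else {} :: (nat \<times> int) set)" for i :: nat
    have A: "disjoint_family A" "(\<Union>i. A i) = S"
      by (auto simp: A_def disjoint_family_on_def)
    define U where "U i = (if i \<in> to_nat ` S then cell (from_nat i) else {})" for i :: nat
    have "U \<in> hausdorff_covers d E"
    proof -
      have "E \<subseteq> (\<Union>i. U i)"
      proof
        fix y assume "y \<in> E"
        then obtain z where z: "z \<in> S" "y \<in> cell z" using S(1) by auto
        then have "y \<in> U (to_nat z)" by (simp add: U_def)
        then show "y \<in> (\<Union>i. U i)" by blast
      qed
      moreover have "bounded (U i) \<and> diameter (U i) \<le> d" for i
      proof (cases "i \<in> to_nat ` S")
        case True
        then obtain z where z: "z \<in> S" "i = to_nat z" by auto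
        have "diameter (cell z) \<le> 1 / 3 ^ fst z" by (rule diameter_cell)
        also have "\<dots> \<le> 1 / 3 ^ k0"
          using deep[OF z(1)] by (intro divide_left_mono power_increasing) auto
        finally show ?thesis using k0 True z by (simp add: U_def diameter_cell)
      qed (use d in \<open>simp add: U_def\<close>)
      ultimately show ?thesis by (simp add: hausdorff_covers_def)
    qed
    then have "hausdorff_premeasure s d E \<le> (\<Sum>i. hausdorff_gauge s (U i))"
      unfolding hausdorff_premeasure_def by (rule INF_lower)
    also have "\<dots> \<le> (\<Sum>i. ?\<kappa> (A i))"
    proof (intro suminf_le summableI)
      fix i show "hausdorff_gauge s (U i) \<le> ?\<kappa> (A i)"
      proof (cases "i \<in> to_nat ` S")
        case True
        then obtain z where z: "z \<in> S" "i = to_nat z" by auto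
        have "diameter (cell z) powr s \<le> (1 / 3 ^ fst z) powr s"
          using s by (intro powr_mono2 diameter_cell diameter_ge_0) auto
        also have "\<dots> = ?x ^ fst z"
          by (simp add: powr_divide powr_minus_divide power_one_over powr_powr powr_power
              mult.commute flip: powr_realpow)
        finally show ?thesis
          using True z s by (simp add: U_def A_def hausdorff_gauge_def ennreal_leI)
      qed (simp add: U_def A_def hausdorff_gauge_def)
    qed
    also have "\<dots> = ?\<kappa> S"
      using suminf_emeasure[OF _ A(1), of "net_weight ?x"] A(2) by simp
    also have "\<dots> \<le> ennreal e"
      using less_imp_le[OF S(2)] by (rule order.trans) (simp add: ennreal_leI)
    finally show ?thesis by simp
  qed
  then have "hausdorff_premeasure s d E \<le> 0" if "0 < d" for d
    using that ennreal_le_epsilon[of 0] by blast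
  then show ?thesis
    unfolding hausdorff_measure_def by (simp add: SUP_eq_const)
qed

text \<open>Raising the exponent from \<open>t\<close> to \<open>t'\<close> does not increase the
  cost, because the diameters are at most 1, and positivity of \<open>t'\<close> lets the radii be
  padded at arbitrarily small cost. The balls are open so that compactness applies to a copy inside
  \<open>Y\<close>.\<close>

lemma hausdorff_null_imp_balls:
  fixes Y :: "real set"
  assumes null: "hausdorff_measure t Y = 0" and t: "0 \<le> t" "t \<le> t'" "0 < t'" and e: "0 < e"
  obtains d v where "\<And>i. 0 < d i" "\<And>N. (\<Sum>i<N. d i powr t') \<le> e"
    "Y \<subseteq> (\<Union>i::nat. ball (v i) (d i))"
proof -
  define e' where "e' = e / (2 * 2 powr t')"
  have e': "0 < e'" using e by (simp add: e'_def)
  have "hausdorff_premeasure t 1 Y \<le> hausdorff_measure t Y"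
    unfolding hausdorff_measure_def by (rule SUP_upper) simp
  then have "hausdorff_premeasure t 1 Y < ennreal e'"
    using null e' by simp
  then obtain U where U: "U \<in> hausdorff_covers 1 Y" "(\<Sum>i. hausdorff_gauge t (U i)) < ennreal e'"
    unfolding hausdorff_premeasure_def by (auto simp: INF_less_iff)
  then have cov: "Y \<subseteq> (\<Union>i. U i)" and bdd: "\<And>i. bounded (U i)" and diam: "\<And>i. diameter (U i) \<le> 1"
    by (auto simp: hausdorff_covers_def)
  have gauge: "ennreal (diameter (U i) powr t') \<le> hausdorff_gauge t (U i)" for i
  proof (cases "U i = {}")
    case False
    have D: "0 \<le> diameter (U i)" using bdd by (rule diameter_ge_0)
    have "diameter (U i) powr t' \<le> 1"
      using D diam[of i] t by (intro powr_le1) auto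
    moreover have "diameter (U i) powr t' \<le> diameter (U i) powr t"
      using D diam[of i] t by (cases "diameter (U i) = 0") (auto intro: powr_mono')
    ultimately show ?thesis
      using False by (auto simp: hausdorff_gauge_def ennreal_leI)
  qed (simp add: hausdorff_gauge_def)
  have sumD: "(\<Sum>i<N. diameter (U i) powr t') \<le> e'" for N
  proof -
    have "ennreal (\<Sum>i<N. diameter (U i) powr t') = (\<Sum>i<N. ennreal (diameter (U i) powr t'))"
      by (simp add: sum_ennreal)
    also have "\<dots> \<le> (\<Sum>i<N. hausdorff_gauge t (U i))"
      by (intro sum_mono gauge)
    also have "\<dots> \<le> (\<Sum>i. hausdorff_gauge t (U i))"
      by (intro sum_le_suminf summableI) auto
    also note less_imp_le[OF U(2)]
    finally show ?thesis using e' by (simp add: ennreal_le_iff)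
  qed
  define \<eta> where "\<eta> i = (e' * (1 / 2) ^ Suc i) powr (1 / t')" for i :: nat
  have \<eta>: "0 < \<eta> i" "\<eta> i powr t' = e' * (1 / 2) ^ Suc i" for i
    using e' t by (simp_all add: \<eta>_def powr_powr)
  have sum\<eta>: "(\<Sum>i<N. \<eta> i powr t') \<le> e'" for N
  proof -
    have "(\<Sum>i<N. (1 / 2) ^ Suc i) \<le> (1::real)"
      using sum_le_suminf[OF sums_summable[OF power_half_series], of "{..<N}"]
        sums_unique[OF power_half_series] by simp
    then show ?thesis
      unfolding \<eta> sum_distrib_left[symmetric] using e' by simp
  qed
  \<comment> \<open>Padding by \<open>\<eta>\<close> makes the radius positive and the factor 2
    makes it exceed the diameter strictly, so the open ball about any point of \<open>U i\<close>
    contains \<open>U i\<close>.\<close>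
  define d where "d i = 2 * max (diameter (U i)) (\<eta> i)" for i
  define v where "v i = (SOME y. y \<in> U i)" for i
  show ?thesis
  proof (rule that)
    show "0 < d i" for i using \<eta>(1)[of i] by (simp add: d_def)
    show "(\<Sum>i<N. d i powr t') \<le> e" for N
    proof -
      have "d i powr t' \<le> 2 powr t' * (diameter (U i) powr t' + \<eta> i powr t')" for i
        using \<eta>(1)[of i] by (auto simp: d_def powr_mult max_def)
      then have "(\<Sum>i<N. d i powr t') \<le> (\<Sum>i<N. 2 powr t' * (diameter (U i) powr t' + \<eta> i powr t'))"
        by (intro sum_mono)
      also have "\<dots> = 2 powr t' * ((\<Sum>i<N. diameter (U i) powr t') + (\<Sum>i<N. \<eta> i powr t'))"
        by (simp add: sum_distrib_left[symmetric] sum.distrib)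
      also have "\<dots> \<le> 2 powr t' * (e' + e')"
        by (intro mult_left_mono add_mono sumD sum\<eta>) auto
      also have "\<dots> = e" by (simp add: e'_def)
      finally show ?thesis .
    qed
    show "Y \<subseteq> (\<Union>i. ball (v i) (d i))"
    proof
      fix y assume "y \<in> Y"
      then obtain i where i: "y \<in> U i" using cov by auto
      then have "v i \<in> U i" unfolding v_def by (rule someI)
      then have "dist (v i) y \<le> diameter (U i)"
        using bdd i by (intro diameter_bounded_bound) auto
      also have "\<dots> < d i" using \<eta>(1)[of i] by (auto simp: d_def max_def)
      finally show "y \<in> (\<Union>i. ball (v i) (d i))" by auto
    qed
  qed
qed

section \<open>Compactness, addresses and dimension of the Cantor set\<close>

lemma compact_cantor_set: "compact cantor_set"
proof -
  have "compact (cantor_stage n)" for n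
  proof (induction n)
    case (Suc n)
    then show ?case
      by (auto intro!: compact_Un compact_continuous_image continuous_intros)
  qed simp
  then have "closed cantor_set"
    unfolding cantor_set_def by (intro closed_INT ballI compact_imp_closed)
  moreover have "cantor_set \<subseteq> cantor_stage 0"
    unfolding cantor_set_def by blast
  ultimately show ?thesis
    using compact_Int_closed[OF compact_Icc, of cantor_set 0 1] by (simp add: Int_absorb1)
qed

lemma compact_scaled_copy: "compact (scaled_copy r c)"
  unfolding scaled_copy_def centered_cantor_set_def
  by (intro compact_continuous_image continuous_intros compact_cantor_set)

text \<open>An endpoint survives every stage: beyond the length of the word, the empty word acts as
  a tail of zeros, and 0 lies in all stages.\<close>

lemma tval_in_cantor_set: "w \<in> words {0, 1} k \<Longrightarrow> tval w \<in> cantor_set"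
proof -
  have "tval w \<in> cantor_stage n" if "set w \<subseteq> {0, 1}" for n
    using that
  proof (induction n arbitrary: w)
    case 0
    then show ?case using tval_bounds[of w "length w"] by (auto simp: words_def)
  next
    case (Suc n)
    show ?case
    proof (cases w)
      case Nil
      have "(0::real) \<in> cantor_stage n" using Suc.IH[of "[]"] by simp
      then show ?thesis using Nil by (force simp: image_iff)
    next
      case (Cons a v)
      then have "tval v \<in> cantor_stage n" "a = 0 \<or> a = 1"
        using Suc by auto
      then show ?thesis using Cons by (auto simp: add_divide_distrib image_iff)
    qed
  qed
  then show "w \<in> words {0, 1} k \<Longrightarrow> tval w \<in> cantor_set"
    by (auto simp: cantor_set_def words_def)
qed

lemma copy_point_in_scaled_copy:
  "w \<in> words {0, 1} k \<Longrightarrow> copy_point r c w \<in> scaled_copy r c"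
  using tval_in_cantor_set[of w k]
  by (auto simp: copy_point_def scaled_copy_def centered_cantor_set_def)

lemma cantor_stage_covered:
  "y \<in> cantor_stage n \<Longrightarrow> \<exists>w\<in>words {0, 1} n. tval w \<le> y \<and> y \<le> tval w + 1 / 3 ^ n"
proof (induction n arbitrary: y)
  case (Suc n)
  then obtain a y' where a: "a \<in> {0, 1::int}" "y' \<in> cantor_stage n" "y = (2 * of_int a + y') / 3"
    by (force simp: add_divide_distrib)
  then obtain w where w: "w \<in> words {0, 1} n" "tval w \<le> y'" "y' \<le> tval w + 1 / 3 ^ n"
    using Suc.IH by blast
  have "y \<le> (2 * of_int a + (tval w + 1 / 3 ^ n)) / 3"
    unfolding a(3) using w by (intro divide_right_mono) auto
  then have "y \<le> tval (a # w) + 1 / 3 ^ Suc n" by (simp add: add_divide_distrib)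
  moreover have "tval (a # w) \<le> y"
    unfolding a(3) tval.simps using w by (intro divide_right_mono) auto
  moreover have "a # w \<in> words {0, 1} (Suc n)"
    using a(1) w(1) by (auto simp: words_def)
  ultimately show ?case by blast
qed auto

text \<open>Stage \<open>n\<close> is covered by at most \<open>2 * 2 ^ n\<close> cells of level
  \<open>n\<close>, of total cost at most \<open>2 * (2 * x) ^ n\<close>. This tends to 0 when
  \<open>x < 1 / 2\<close>, that is, for exponents above \<open>ln 2 / ln 3\<close>.\<close>

lemma hausdorff_dim_cantor_le: "hausdorff_dim centered_cantor_set \<le> ennreal (ln 2 / ln 3)"
proof -
  have null: "hausdorff_measure t centered_cantor_set = 0" if t: "ln 2 / ln 3 < t" for t
  proof -
    define x where "x = 3 powr - t"
    have t0: "0 < t" using t by (rule less_trans[rotated]) simp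
    have x0: "0 < x" by (simp add: x_def)
    have "2 * x = exp (ln 2 - t * ln 3)"
      by (simp add: x_def powr_def exp_diff exp_minus divide_inverse)
    also have "\<dots> < 1"
      using t by (simp add: field_simps)
    finally have x1: "2 * x < 1" .
    have "net_content x centered_cantor_set \<le> ennreal (2 * (2 * x) ^ n)" for n
    proof -
      \<comment> \<open>An interval of length \<open>1 / 3 ^ n\<close> meets the cell of its left
        end and at most the next one, hence the offsets 0 and 1.\<close>
      define S where "S = (\<lambda>(w, j). (n, \<lfloor>3 ^ n * (tval w - 1 / 2)\<rfloor> + j)) ` (words {0, 1} n \<times> {0, 1::int})"
      have fin: "finite S" by (simp add: S_def)
      have "card S \<le> card (words {0, 1} n \<times> {0, 1::int})"
        unfolding S_def by (rule card_image_le) simp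
      then have card: "card S \<le> 2 ^ n * 2"
        by (simp add: card_words card_cartesian_product flip: numeral_2_eq_2)
      have "centered_cantor_set \<subseteq> \<Union> (cell ` S)"
      proof
        fix y assume "y \<in> centered_cantor_set"
        then have "y + 1 / 2 \<in> cantor_stage n"
          by (auto simp: centered_cantor_set_def cantor_set_def)
        then obtain w where w: "w \<in> words {0, 1} n" "tval w \<le> y + 1 / 2" "y + 1 / 2 \<le> tval w + 1 / 3 ^ n"
          using cantor_stage_covered by blast
        define a where "a = 3 ^ n * (tval w - 1 / 2)"
        have "a \<le> 3 ^ n * y"
          unfolding a_def using w by (intro mult_left_mono) auto
        moreover have "3 ^ n * y \<le> 3 ^ n * (tval w - 1 / 2 + 1 / 3 ^ n)"
          using w by (intro mult_left_mono) auto
        then have "3 ^ n * y \<le> a + 1"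
          by (simp add: a_def distrib_left)
        ultimately have "\<lfloor>3 ^ n * y\<rfloor> = \<lfloor>a\<rfloor> + 0 \<or> \<lfloor>3 ^ n * y\<rfloor> = \<lfloor>a\<rfloor> + 1"
          by linarith
        then have "(n, \<lfloor>3 ^ n * y\<rfloor>) \<in> S"
          unfolding S_def a_def using w(1) by (auto simp: image_iff Bex_def)
        then show "y \<in> \<Union> (cell ` S)" unfolding mem_cells_iff by blast
      qed
      then have "net_content x centered_cantor_set \<le> emeasure (net_weight x) S"
        by (rule net_content_le)
      also have "\<dots> = (\<Sum>z\<in>S. ennreal (x ^ fst z))"
        using fin by (subst emeasure_eq_sum_singleton) auto
      also have "\<dots> = (\<Sum>z\<in>S. ennreal (x ^ n))"
        by (intro sum.cong) (auto simp: S_def)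
      also have "\<dots> = ennreal (\<Sum>z\<in>S. x ^ n)"
        using x0 by (intro sum_ennreal) auto
      also have "\<dots> \<le> ennreal (real (2 ^ n * 2) * x ^ n)"
        using card x0 by (intro ennreal_leI) (simp only: sum_constant of_nat_le_iff mult_right_mono zero_le_power less_imp_le)
      finally show ?thesis by (simp add: power_mult_distrib mult_ac)
    qed
    moreover have "(\<lambda>n. ennreal (2 * (2 * x) ^ n)) \<longlonglongrightarrow> ennreal (2 * 0)"
      using x0 x1 by (intro tendsto_ennrealI tendsto_mult tendsto_const LIMSEQ_realpow_zero) auto
    ultimately have "net_content x centered_cantor_set \<le> 0"
      by (intro LIMSEQ_le_const[of _ 0]) auto
    then show ?thesis
      using t0 unfolding x_def by (intro hausdorff_measure_net_null) auto
  qed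
  show ?thesis
  proof (rule ennreal_le_epsilon)
    fix e :: real assume "0 < e"
    then have "hausdorff_measure (ln 2 / ln 3 + e) centered_cantor_set = 0" by (intro null) simp
    then have "hausdorff_dim centered_cantor_set \<le> ennreal (ln 2 / ln 3 + e)"
      unfolding hausdorff_dim_def using \<open>0 < e\<close>
      by (intro Inf_lower CollectI exI[of _ "ln 2 / ln 3 + e"]) (auto intro!: add_nonneg_nonneg)
    also have "\<dots> = ennreal (ln 2 / ln 3) + ennreal e"
      using \<open>0 < e\<close> by (intro ennreal_plus) auto
    finally show "hausdorff_dim centered_cantor_set \<le> ennreal (ln 2 / ln 3) + ennreal e" .
  qed
qed

section \<open>Frostman weights\<close>

text \<open>The weight is built from the finest level upwards: one point of mass
  \<open>x ^ k\<close> in each finest cell that meets \<open>E\<close>, then unions of three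
  children, scaled down where they exceed the allowance of the parent. Throughout, the total mass
  dominates the content, by subadditivity or because the parent cell is itself a cover.\<close>

lemma net_frostman:
  assumes x: "0 < x"
  shows "\<exists>F p. finite F \<and> F \<subseteq> E \<inter> cell (k, q) \<and> (\<forall>c. 0 \<le> p c) \<and>
    (\<forall>k' q'. k \<le> k' \<longrightarrow> k' \<le> k + j \<longrightarrow> sum p (F \<inter> cell (k', q')) \<le> x ^ k') \<and>
    net_content x (E \<inter> cell (k, q)) \<le> ennreal (sum p F)"
proof (induction j arbitrary: k q)
  case 0
  show ?case
  proof (cases "E \<inter> cell (k, q) = {}")
    case True
    then show ?thesis using x by (intro exI[of _ "{}"] exI[of _ "\<lambda>_. 0"]) auto
  next
    case False
    then obtain y where y: "y \<in> E \<inter> cell (k, q)" by auto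
    have "net_content x (E \<inter> cell (k, q)) \<le> ennreal (x ^ k)"
      using net_content_cell[of "E \<inter> cell (k, q)" "(k, q)" x] by simp
    moreover have "sum (\<lambda>_. x ^ k) ({y} \<inter> B) \<le> x ^ k" for B
      using x by (cases "y \<in> B") auto
    ultimately show ?thesis
      using x y by (intro exI[of _ "{y}"] exI[of _ "\<lambda>_. x ^ k"]) auto
  qed
next
  case (Suc j)
  obtain G P where G: "\<And>q. finite (G q)" "\<And>q. G q \<subseteq> E \<inter> cell (Suc k, q)" "\<And>q c. 0 \<le> P q c"
    "\<And>q k' q'. Suc k \<le> k' \<Longrightarrow> k' \<le> k + Suc j \<Longrightarrow> sum (P q) (G q \<inter> cell (k', q')) \<le> x ^ k'"
    "\<And>q. net_content x (E \<inter> cell (Suc k, q)) \<le> ennreal (sum (P q) (G q))"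
    using Suc.IH[of "Suc k"] by (simp only: add_Suc_shift) metis
  define I where "I = {3 * q .. 3 * q + 2}"
  have child: "cell (Suc k, q') \<subseteq> cell (k, q)" if "q' \<in> I" for q'
    using floor_power_div[of k "Suc k"] that by (auto simp: cell_def I_def)
  have parent: "\<lfloor>3 ^ Suc k * y\<rfloor> \<in> I" if "y \<in> cell (k, q)" for y
    using floor_power_div[of k "Suc k" y] that by (auto simp: cell_def I_def)
  define F where "F = (\<Union>q'\<in>I. G q')"
  \<comment> \<open>Distinct children are disjoint, so their weights glue to one function that
    agrees with \<open>P q'\<close> on \<open>G q'\<close>.\<close>
  define p where "p c = P \<lfloor>3 ^ Suc k * c\<rfloor> c" for c
  have G_floor: "\<lfloor>3 ^ Suc k * c\<rfloor> = q'" if "c \<in> G q'" for c q'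
    using G(2)[of q'] that by (auto simp: cell_def)
  have finF: "finite F" by (simp add: F_def G(1) I_def)
  have F_sub: "F \<subseteq> E \<inter> cell (k, q)" using G(2) child by (simp add: F_def) blast
  have p0: "0 \<le> p c" for c by (simp add: p_def G(3))
  have sum_F: "sum p F = (\<Sum>q'\<in>I. sum (P q') (G q'))"
  proof -
    have "sum p F = (\<Sum>q'\<in>I. sum p (G q'))"
      unfolding F_def using G(1) G_floor by (intro sum.UNION_disjoint) (auto simp: I_def, blast)
    also have "\<dots> = (\<Sum>q'\<in>I. sum (P q') (G q'))"
      by (intro sum.cong refl) (simp only: p_def G_floor)
    finally show ?thesis .
  qed
  have content: "net_content x (E \<inter> cell (k, q)) \<le> ennreal (sum p F)"
  proof -
    have "E \<inter> cell (k, q) = (\<Union>q'\<in>I. E \<inter> cell (Suc k, q'))"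
      using parent child by (force simp: cell_def)
    then have "net_content x (E \<inter> cell (k, q)) \<le> (\<Sum>q'\<in>I. net_content x (E \<inter> cell (Suc k, q')))"
      using net_content_UN_finite[of I x "\<lambda>q'. E \<inter> cell (Suc k, q')"]
      by (simp only: I_def finite_atLeastAtMost_int)
    also have "\<dots> \<le> (\<Sum>q'\<in>I. ennreal (sum (P q') (G q')))"
      by (intro sum_mono G)
    also have "\<dots> = ennreal (sum p F)"
      unfolding sum_F by (intro sum_ennreal sum_nonneg G)
    finally show ?thesis .
  qed
  have small: "sum p (F \<inter> cell (k', q')) \<le> x ^ k'" if k': "Suc k \<le> k'" "k' \<le> k + Suc j" for k' q'
  proof (cases "F \<inter> cell (k', q') = {}")
    case False
    then obtain c where c: "c \<in> F" "c \<in> cell (k', q')" by auto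
    define i where "i = \<lfloor>3 ^ Suc k * c\<rfloor>"
    have same: "\<lfloor>3 ^ Suc k * c'\<rfloor> = i" if "c' \<in> cell (k', q')" for c'
      using that c(2) floor_power_div[OF k'(1)] by (simp add: cell_def i_def)
    have "i \<in> I"
      using parent[of c] F_sub c(1) unfolding i_def by blast
    then have "G i \<subseteq> F" by (auto simp: F_def)
    moreover have "c' \<in> G i" if "c' \<in> F" "c' \<in> cell (k', q')" for c'
      using that same[of c'] G_floor[of c'] unfolding F_def by auto
    ultimately have "F \<inter> cell (k', q') = G i \<inter> cell (k', q')"
      by blast
    then have "sum p (F \<inter> cell (k', q')) = sum (P i) (G i \<inter> cell (k', q'))"
      using same by (auto simp: p_def intro!: sum.cong)
    then show ?thesis using G(4)[OF k'] by simp
  qed (use x in simp)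
  define T where "T = sum p F"
  show ?case
  proof (cases "T \<le> x ^ k")
    case True
    have "sum p (F \<inter> cell (k', q')) \<le> x ^ k'" if k': "k \<le> k'" "k' \<le> k + Suc j" for k' q'
    proof (cases "k' = k")
      case True
      have "sum p (F \<inter> cell (k', q')) \<le> T"
        unfolding T_def using finF p0 by (intro sum_mono2) auto
      then show ?thesis using True \<open>T \<le> x ^ k\<close> by simp
    qed (use small k' in auto)
    then show ?thesis
      using finF F_sub p0 content by (intro exI[of _ F] exI[of _ p]) auto
  next
    case False
    then have T: "x ^ k < T" by simp
    \<comment> \<open>Scaling by \<open>\<rho>\<close> gives the cell mass exactly
      \<open>x ^ k\<close>, which is the cost of the cell as a cover and so still dominates the
      content.\<close>
    define \<rho> where "\<rho> = x ^ k / T"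
    have T0: "0 < T" using T x by (meson less_trans zero_less_power)
    have \<rho>: "0 \<le> \<rho>" "\<rho> \<le> 1" "\<rho> * T = x ^ k"
      using T T0 x by (simp_all add: \<rho>_def)
    have sum\<rho>: "(\<Sum>c\<in>A. \<rho> * p c) = \<rho> * sum p A" for A
      by (simp add: sum_distrib_left)
    have "\<rho> * sum p (F \<inter> cell (k', q')) \<le> x ^ k'" if k': "k \<le> k'" "k' \<le> k + Suc j" for k' q'
    proof (cases "k' = k")
      case True
      have "\<rho> * sum p (F \<inter> cell (k', q')) \<le> \<rho> * T"
        unfolding T_def using finF p0 \<rho> by (intro mult_left_mono sum_mono2) auto
      then show ?thesis using True \<rho> by simp
    next
      case False
      then have "sum p (F \<inter> cell (k', q')) \<le> x ^ k'" using small k' by auto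
      moreover have "0 \<le> sum p (F \<inter> cell (k', q'))" using p0 by (intro sum_nonneg) auto
      ultimately show ?thesis
        using mult_right_mono[OF \<rho>(2), of "sum p (F \<inter> cell (k', q'))"] by simp
    qed
    moreover have "net_content x (E \<inter> cell (k, q)) \<le> ennreal (\<rho> * T)"
      using net_content_cell[of "E \<inter> cell (k, q)" "(k, q)" x] \<rho> by simp
    ultimately show ?thesis
      using finF F_sub p0 \<rho>
      by (intro exI[of _ F] exI[of _ "\<lambda>c. \<rho> * p c"]) (simp add: sum\<rho> T_def)
  qed
qed

text \<open>An interval of length \<open>10 * a / 3 ^ m\<close> meets at most two cells of level
  \<open>m - g\<close>, because \<open>10 * a \<le> 3 ^ g\<close>; hence the constant
  \<open>2 / x ^ g\<close>. For \<open>m < g\<close> the total mass 1 suffices. Division by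
  \<open>a\<close> turns the radius into the one used in \<open>energy_bound\<close>.\<close>

lemma net_frostman_intervals:
  assumes x: "0 < x" "x \<le> 1" and E: "E \<subseteq> cell (0, q)" and a: "0 < a" "10 * a \<le> 3 ^ g"
  obtains F p where "finite F" "F \<subseteq> E" "\<And>c. 0 \<le> p c" "sum p F \<le> 1"
    "net_content x E \<le> ennreal (sum p F)"
    "\<And>m z. m \<le> M \<Longrightarrow> (\<Sum>c\<in>{c \<in> F. \<bar>c - z\<bar> \<le> 5 * a / 3 ^ m}. p c) \<le> 2 / x ^ g * x ^ m"
proof -
  have EE: "E \<inter> cell (0, q) = E" using E by blast
  obtain F p where Fp: "finite F" "F \<subseteq> E" "\<And>c. 0 \<le> p c"
    "\<And>k q'. k \<le> M \<Longrightarrow> sum p (F \<inter> cell (k, q')) \<le> x ^ k"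
    "net_content x E \<le> ennreal (sum p F)"
    using net_frostman[OF x(1), of E 0 q M] unfolding EE by (metis add_0 inf_le1 EE le0)
  have "F \<inter> cell (0, q) = F" using E Fp(2) by blast
  then have one: "sum p F \<le> 1" using Fp(4)[of 0 q] by simp
  show ?thesis
  proof (rule that[OF Fp(1-3) one Fp(5)])
    fix m z assume m: "m \<le> M"
    let ?A = "{c \<in> F. \<bar>c - z\<bar> \<le> 5 * a / 3 ^ m}"
    show "sum p ?A \<le> 2 / x ^ g * x ^ m"
    proof (cases "g \<le> m")
      case True
      define j where "j = m - g"
      define i where "i = \<lfloor>3 ^ j * (z - 5 * a / 3 ^ m)\<rfloor>"
      have jm: "(3::real) ^ m = 3 ^ j * 3 ^ g" "x ^ m = x ^ j * x ^ g"
        using True by (simp_all add: j_def flip: power_add)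
      have width: "3 ^ j * (10 * a / 3 ^ m) \<le> 1"
        using a(2) by (simp add: jm)
      have "?A \<subseteq> (F \<inter> cell (j, i)) \<union> (F \<inter> cell (j, i + 1))"
      proof
        fix c assume c: "c \<in> ?A"
        then have "z - 5 * a / 3 ^ m \<le> c" "c \<le> z - 5 * a / 3 ^ m + 10 * a / 3 ^ m"
          by (auto simp: abs_le_iff)
        then have "3 ^ j * (z - 5 * a / 3 ^ m) \<le> 3 ^ j * c"
          "3 ^ j * c \<le> 3 ^ j * (z - 5 * a / 3 ^ m + 10 * a / 3 ^ m)"
          by (auto intro: mult_left_mono)
        then have "3 ^ j * (z - 5 * a / 3 ^ m) \<le> 3 ^ j * c"
          "3 ^ j * c \<le> 3 ^ j * (z - 5 * a / 3 ^ m) + 1"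
          using width unfolding distrib_left by linarith+
        then have "\<lfloor>3 ^ j * c\<rfloor> = i \<or> \<lfloor>3 ^ j * c\<rfloor> = i + 1"
          unfolding i_def by linarith
        then show "c \<in> (F \<inter> cell (j, i)) \<union> (F \<inter> cell (j, i + 1))"
          using c by (auto simp: cell_def)
      qed
      then have "sum p ?A \<le> sum p ((F \<inter> cell (j, i)) \<union> (F \<inter> cell (j, i + 1)))"
        using Fp by (intro sum_mono2) auto
      also have "\<dots> \<le> sum p (F \<inter> cell (j, i)) + sum p (F \<inter> cell (j, i + 1))"
        using Fp by (subst sum_Un) (auto intro!: sum_nonneg)
      also have "\<dots> \<le> x ^ j + x ^ j"
        using m by (intro add_mono Fp) (auto simp: j_def)
      also have "\<dots> = 2 / x ^ g * x ^ m"
        using x by (simp add: jm)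
      finally show ?thesis .
    next
      case False
      have "sum p ?A \<le> sum p F" using Fp by (intro sum_mono2) auto
      also note one
      also have "1 \<le> x ^ m / x ^ g"
        using False x power_decreasing[of m g x] by simp
      also have "\<dots> \<le> 2 / x ^ g * x ^ m"
        using x by (simp add: divide_right_mono)
      finally show ?thesis .
    qed
  qed
qed

text \<open>Cauchy-Schwarz over the values in \<open>Q\<close>: the squared masses of the fibres,
  expanded, count weighted pairs with equal value.\<close>

lemma sum_fibres_squared:
  fixes p :: "'a \<Rightarrow> real"
  assumes fin: "finite X" "finite Q" and p: "\<And>y. y \<in> X \<Longrightarrow> 0 \<le> p y"
  shows "(\<Sum>y\<in>{y \<in> X. f y \<in> Q}. p y)\<^sup>2 \<le> card Q * (\<Sum>y\<in>X. \<Sum>y'\<in>X. p y * p y' * of_bool (f y = f y'))"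
proof -
  define m where "m q = (\<Sum>y\<in>X. p y * of_bool (f y = q))" for q
  have "(\<Sum>y\<in>{y \<in> X. f y \<in> Q}. p y) = (\<Sum>y\<in>X. p y * of_bool (f y \<in> Q))"
    using fin(1) by (intro sum.mono_neutral_cong_left) auto
  also have "\<dots> = (\<Sum>y\<in>X. \<Sum>q\<in>Q. p y * of_bool (f y = q))"
    using fin(2) by (intro sum.cong refl) (simp add: sum_distrib_left[symmetric] sum_of_bool_eq of_bool_def)
  also have "\<dots> = (\<Sum>q\<in>Q. m q)"
    unfolding m_def by (rule sum.swap)
  finally have "(\<Sum>y\<in>{y \<in> X. f y \<in> Q}. p y)\<^sup>2 = (\<Sum>q\<in>Q. m q)\<^sup>2" by simp
  also have "\<dots> \<le> (\<Sum>q\<in>Q. (m q)\<^sup>2) * card Q"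
    using sum_squared_le_sum_of_squares by blast
  also have "(\<Sum>q\<in>Q. (m q)\<^sup>2) = (\<Sum>y\<in>X. \<Sum>y'\<in>X. p y * p y' * (\<Sum>q\<in>Q. of_bool (f y = q) * of_bool (f y' = q)))"
  proof -
    have "(\<Sum>q\<in>Q. (m q)\<^sup>2) = (\<Sum>q\<in>Q. \<Sum>y\<in>X. \<Sum>y'\<in>X. p y * p y' * (of_bool (f y = q) * of_bool (f y' = q)))"
      unfolding m_def power2_eq_square sum_product by (intro sum.cong refl) (simp only: mult_ac)
    also have "\<dots> = (\<Sum>y\<in>X. \<Sum>q\<in>Q. \<Sum>y'\<in>X. p y * p y' * (of_bool (f y = q) * of_bool (f y' = q)))"
      by (rule sum.swap)
    also have "\<dots> = (\<Sum>y\<in>X. \<Sum>y'\<in>X. \<Sum>q\<in>Q. p y * p y' * (of_bool (f y = q) * of_bool (f y' = q)))"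
      by (intro sum.cong refl sum.swap)
    finally show ?thesis by (simp only: sum_distrib_left)
  qed
  also have "\<dots> \<le> (\<Sum>y\<in>X. \<Sum>y'\<in>X. p y * p y' * of_bool (f y = f y'))"
  proof (intro sum_mono mult_left_mono)
    fix y y'
    have "(\<Sum>q\<in>Q. of_bool (f y = q) * of_bool (f y' = q)) = (\<Sum>q\<in>Q \<inter> {f y}. of_bool (f y' = q) :: real)"
      using fin(2) by (intro sum.mono_neutral_cong_right) auto
    also have "\<dots> \<le> of_bool (f y = f y')"
      by (cases "f y \<in> Q") auto
    finally show "(\<Sum>q\<in>Q. of_bool (f y = q) * of_bool (f y' = q)) \<le> (of_bool (f y = f y') :: real)" .
  qed (use p in auto)
  finally show ?thesis by (simp add: mult.commute mult_right_mono)
qed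

section \<open>Mass distribution along a cover\<close>

text \<open>\<open>sum_fibres_squared\<close> for pairs of a centre and a word, with the index of
  the triadic cell as value. Points in the same cell are close, so the pair sum is controlled by the
  energy.\<close>

lemma level_mass:
  fixes p r :: "real \<Rightarrow> real" and S :: real
  assumes F: "finite F" "\<And>c. c \<in> F \<Longrightarrow> 0 \<le> p c" and Q: "finite Q"
    and energy: "(\<Sum>c\<in>F. \<Sum>c'\<in>F. p c * p c' * (\<Sum>u\<in>words {0, 1} k. \<Sum>v\<in>words {0, 1} k.
        of_bool (\<bar>copy_point (r c) c u - copy_point (r c') c' v\<bar> \<le> 4 / 3 ^ k))) \<le> S"
  shows "(\<Sum>c\<in>F. p c * real (card {u \<in> words {0, 1} k. \<lfloor>3 ^ k * copy_point (r c) c u\<rfloor> \<in> Q}))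
    \<le> sqrt (card Q * S)"
proof (rule real_le_rsqrt)
  let ?W = "words {0, 1} k"
  define f where "f = (\<lambda>(c, u). \<lfloor>3 ^ k * copy_point (r c) c u\<rfloor>)"
  define P :: "real \<times> int list \<Rightarrow> real" where "P = (\<lambda>(c, u). p c)"
  have "(\<Sum>c\<in>F. p c * real (card {u \<in> ?W. \<lfloor>3 ^ k * copy_point (r c) c u\<rfloor> \<in> Q}))
    = (\<Sum>c\<in>F. \<Sum>u\<in>{u \<in> ?W. f (c, u) \<in> Q}. P (c, u))"
    by (simp add: f_def P_def mult.commute)
  also have "\<dots> = (\<Sum>y\<in>Sigma F (\<lambda>c. {u \<in> ?W. f (c, u) \<in> Q}). P y)"
    using F(1) by (subst sum.Sigma) auto
  also have "Sigma F (\<lambda>c. {u \<in> ?W. f (c, u) \<in> Q}) = {y \<in> F \<times> ?W. f y \<in> Q}"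
    by auto
  finally have "(\<Sum>c\<in>F. p c * real (card {u \<in> ?W. \<lfloor>3 ^ k * copy_point (r c) c u\<rfloor> \<in> Q}))\<^sup>2
    = (\<Sum>y\<in>{y \<in> F \<times> ?W. f y \<in> Q}. P y)\<^sup>2" by simp
  also have "\<dots> \<le> card Q * (\<Sum>y\<in>F \<times> ?W. \<Sum>y'\<in>F \<times> ?W. P y * P y' * of_bool (f y = f y'))"
    using F Q by (intro sum_fibres_squared) (auto simp: P_def)
  also have "\<dots> \<le> card Q * S"
  proof (intro mult_left_mono order.trans[OF _ energy])
    have near: "of_bool (f (c, u) = f (c', v))
      \<le> (of_bool (\<bar>copy_point (r c) c u - copy_point (r c') c' v\<bar> \<le> 4 / 3 ^ k) :: real)" for c u c' v
    proof -
      have "\<bar>copy_point (r c) c u - copy_point (r c') c' v\<bar> \<le> 4 / 3 ^ k" if "f (c, u) = f (c', v)"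
      proof -
        have "\<bar>3 ^ k * copy_point (r c) c u - 3 ^ k * copy_point (r c') c' v\<bar> \<le> 4"
          using that unfolding f_def by simp linarith
        also have "3 ^ k * copy_point (r c) c u - 3 ^ k * copy_point (r c') c' v
          = 3 ^ k * (copy_point (r c) c u - copy_point (r c') c' v)"
          by (simp add: right_diff_distrib)
        finally show ?thesis
          unfolding abs_mult by (simp add: pos_le_divide_eq mult.commute)
      qed
      then show ?thesis by auto
    qed
    have "(\<Sum>y\<in>F \<times> ?W. \<Sum>y'\<in>F \<times> ?W. P y * P y' * of_bool (f y = f y'))
      = (\<Sum>c\<in>F. \<Sum>u\<in>?W. \<Sum>c'\<in>F. \<Sum>v\<in>?W. p c * p c' * of_bool (f (c, u) = f (c', v)))"
      by (simp only: sum.cartesian_product' P_def prod.case)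
    also have "\<dots> = (\<Sum>c\<in>F. \<Sum>c'\<in>F. \<Sum>u\<in>?W. \<Sum>v\<in>?W. p c * p c' * of_bool (f (c, u) = f (c', v)))"
      by (intro sum.cong refl sum.swap)
    also have "\<dots> \<le> (\<Sum>c\<in>F. \<Sum>c'\<in>F. \<Sum>u\<in>?W. \<Sum>v\<in>?W. p c * p c' *
        of_bool (\<bar>copy_point (r c) c u - copy_point (r c') c' v\<bar> \<le> 4 / 3 ^ k))"
      using F(2) by (intro sum_mono mult_left_mono near) auto
    finally show "(\<Sum>y\<in>F \<times> ?W. \<Sum>y'\<in>F \<times> ?W. P y * P y' * of_bool (f y = f y'))
      \<le> (\<Sum>c\<in>F. \<Sum>c'\<in>F. p c * p c' * (\<Sum>u\<in>?W. \<Sum>v\<in>?W.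
        of_bool (\<bar>copy_point (r c) c u - copy_point (r c') c' v\<bar> \<le> 4 / 3 ^ k)))"
      by (simp only: sum_distrib_left)
  qed simp
  finally show "(\<Sum>c\<in>F. p c * real (card {u \<in> ?W. \<lfloor>3 ^ k * copy_point (r c) c u\<rfloor> \<in> Q}))\<^sup>2
    \<le> card Q * S" .
qed

lemma card_words_prefix:
  assumes "m \<le> n" "H \<subseteq> words {0, 1} m"
  shows "card {w \<in> words {0, 1} n. take m w \<in> H} = card H * 2 ^ (n - m)"
proof -
  have "{w \<in> words {0, 1} n. take m w \<in> H} = (\<lambda>(u, v). u @ v) ` (H \<times> words {0, 1} (n - m))"
  proof (intro equalityI subsetI)
    fix w assume "w \<in> {w \<in> words {0, 1} n. take m w \<in> H}"
    then show "w \<in> (\<lambda>(u, v). u @ v) ` (H \<times> words {0, 1} (n - m))"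
      by (intro image_eqI[of _ _ "(take m w, drop m w)"]) (auto simp: words_def dest: in_set_dropD)
  next
    fix w assume "w \<in> (\<lambda>(u, v). u @ v) ` (H \<times> words {0, 1} (n - m))"
    then obtain u v where uv: "w = u @ v" "u \<in> H" "v \<in> words {0, 1} (n - m)" by auto
    then have "u \<in> words {0, 1} m" using assms(2) by blast
    then show "w \<in> {w \<in> words {0, 1} n. take m w \<in> H}"
      using uv assms(1) by (auto simp: words_def)
  qed
  moreover have "inj_on (\<lambda>(u, v). u @ v) (H \<times> words {0, 1} (n - m))"
    using assms(2) by (auto simp: inj_on_def words_def)
  ultimately show ?thesis
    by (simp add: card_image card_cartesian_product card_words flip: numeral_2_eq_2)
qed

text \<open>Cutting off the tail moves the point by at most \<open>2 / 3 ^ k\<close>, so the prefix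
  is within \<open>3 / 3 ^ k\<close> of \<open>v\<close> and the floors differ by at most 4. This is
  the origin of the 9 cells per ball in \<open>mass_bound\<close>.\<close>

lemma prefix_near_centre:
  fixes r c v :: real
  assumes r: "0 \<le> r" "r \<le> 2" and w: "w \<in> words {0, 1} n" and k: "k \<le> n"
    and near: "\<bar>copy_point r c w - v\<bar> \<le> 1 / 3 ^ k"
  shows "\<lfloor>3 ^ k * copy_point r c (take k w)\<rfloor> \<in> {\<lfloor>3 ^ k * v\<rfloor> - 4 .. \<lfloor>3 ^ k * v\<rfloor> + 4}"
proof -
  have drop: "drop k w \<in> words {0, 1} (n - k)"
    using w by (auto simp: words_def dest: in_set_dropD)
  have "copy_point r c w = copy_point r c (take k w) + r * tval (drop k w) / 3 ^ k"
    using copy_point_append[of r c "take k w" "drop k w"] w k by (simp add: words_def min_absorb2)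
  then have "3 ^ k * copy_point r c (take k w) - 3 ^ k * v
    = 3 ^ k * (copy_point r c w - v) - r * tval (drop k w)"
    by (simp add: algebra_simps)
  moreover have "0 \<le> r * tval (drop k w)" "r * tval (drop k w) \<le> 2"
    using tval_bounds[OF drop] r mult_mono[of r 2 "tval (drop k w)" 1] by auto
  moreover have "\<bar>3 ^ k * (copy_point r c w - v)\<bar> \<le> 1"
    using mult_left_mono[OF near, of "3 ^ k"] unfolding abs_mult by simp
  ultimately have "\<bar>3 ^ k * copy_point r c (take k w) - 3 ^ k * v\<bar> \<le> 3"
    by linarith
  then show ?thesis by simp linarith
qed

text \<open>Every long word of every copy is caught by some ball \<open>i\<close>, and its prefix of
  \<open>k (\<nu> i)\<close> digits then lands in one of few triadic cells. So the fractions of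
  prefixes caught at levels up to \<open>M\<close> add up to at least 1 for each centre, whereas
  \<open>level_mass\<close> bounds their weighted sum at level \<open>n\<close> by a multiple of
  \<open>\<omega> ^ n\<close>.\<close>

lemma mass_bound:
  fixes p r :: "real \<Rightarrow> real" and centre :: "nat \<Rightarrow> real" and \<nu> :: "nat \<Rightarrow> nat"
  assumes F: "finite F" "\<And>c. c \<in> F \<Longrightarrow> 0 \<le> p c" "sum p F \<le> 1"
    and r: "\<And>c. c \<in> F \<Longrightarrow> 1 \<le> r c \<and> r c \<le> 1 + 1 / 3 ^ (2 * l)"
    and l: "0 < l"
    and frostman: "\<And>n z. n \<le> M \<Longrightarrow>
      (\<Sum>c\<in>{c \<in> F. \<bar>c - z\<bar> \<le> 5 / 3 ^ (n * l)}. p c) \<le> A * x ^ (n * l)"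
    and x: "1 / 2 \<le> x" and q: "0 < q" "q \<le> 1" and A: "0 \<le> A"
    and \<omega>: "0 < \<omega>" "\<omega> < 1" "3 / 4 \<le> \<omega> ^ 4" "(1 + 2 * q) ^ (2 * l) * x ^ l / q ^ 3 \<le> \<omega> ^ 4"
    and \<nu>: "\<And>i. i < N \<Longrightarrow> \<nu> i \<le> M"
    and cover: "\<And>c w. c \<in> F \<Longrightarrow> w \<in> words {0, 1} (M * (2 * l)) \<Longrightarrow>
      \<exists>i<N. \<bar>copy_point (r c) c w - centre i\<bar> \<le> 1 / 3 ^ (\<nu> i * (2 * l))"
    and count: "\<And>n. real (card {i. i < N \<and> \<nu> i = n}) \<le> D * (2 ^ (2 * l) / \<omega>\<^sup>2) ^ n"
  shows "sum p F \<le> sqrt (9 * D * (A + 5)) / (1 - \<omega>)"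
proof -
  define k where "k n = n * (2 * l)" for n
  define Q where "Q n = (\<Union>i\<in>{i. i < N \<and> \<nu> i = n}.
    {\<lfloor>3 ^ k n * centre i\<rfloor> - 4 .. \<lfloor>3 ^ k n * centre i\<rfloor> + 4})" for n
  define H where "H n c = {u \<in> words {0, 1} (k n). \<lfloor>3 ^ k n * copy_point (r c) c u\<rfloor> \<in> Q n}" for n c
  have D0: "0 \<le> D"
    using order.trans[OF of_nat_0_le_iff count[of 0]] by simp
  have finQ: "finite (Q n)" for n by (auto simp: Q_def)
  have cardQ: "real (card (Q n)) \<le> 9 * (D * (2 ^ (2 * l) / \<omega>\<^sup>2) ^ n)" for n
  proof -
    have "card (Q n) \<le> (\<Sum>i\<in>{i. i < N \<and> \<nu> i = n}. card {\<lfloor>3 ^ k n * centre i\<rfloor> - 4 .. \<lfloor>3 ^ k n * centre i\<rfloor> + 4})"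
      unfolding Q_def by (rule card_UN_le) simp
    also have "\<dots> = 9 * card {i. i < N \<and> \<nu> i = n}" by simp
    finally have "real (card (Q n)) \<le> real (9 * card {i. i < N \<and> \<nu> i = n})"
      by (rule of_nat_mono)
    then show ?thesis using count[of n] by simp
  qed
  have "1 / (3::real) ^ (2 * l) \<le> 1" by simp
  then have r2: "0 \<le> r c \<and> r c \<le> 2" if "c \<in> F" for c
    using r[OF that] by linarith
  have one: "1 \<le> (\<Sum>n\<le>M. real (card (H n c)) / 2 ^ k n)" if c: "c \<in> F" for c
  proof -
    have "words {0, 1} (k M) \<subseteq> (\<Union>n\<in>{..M}. {w \<in> words {0, 1} (k M). take (k n) w \<in> H n c})"
    proof
      fix w assume w: "w \<in> words {0, 1} (k M)"
      then obtain i where i: "i < N" "\<bar>copy_point (r c) c w - centre i\<bar> \<le> 1 / 3 ^ k (\<nu> i)"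
        using cover[OF c] unfolding k_def by blast
      have le: "k (\<nu> i) \<le> k M" using \<nu>[OF i(1)] by (simp add: k_def)
      have "\<lfloor>3 ^ k (\<nu> i) * copy_point (r c) c (take (k (\<nu> i)) w)\<rfloor> \<in> Q (\<nu> i)"
        unfolding Q_def using prefix_near_centre[OF _ _ w le i(2)] r2[OF c] i(1) by blast
      moreover have "take (k (\<nu> i)) w \<in> words {0, 1} (k (\<nu> i))"
        using w le by (auto simp: words_def dest: in_set_takeD)
      ultimately show "w \<in> (\<Union>n\<in>{..M}. {w \<in> words {0, 1} (k M). take (k n) w \<in> H n c})"
        using w \<nu>[OF i(1)] by (auto simp: H_def)
    qed
    then have "card (words {0, 1} (k M)) \<le> card (\<Union>n\<in>{..M}. {w \<in> words {0, 1} (k M). take (k n) w \<in> H n c})"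
      by (intro card_mono) auto
    also have "\<dots> \<le> (\<Sum>n\<le>M. card {w \<in> words {0, 1} (k M). take (k n) w \<in> H n c})"
      by (rule card_UN_le) simp
    also have "\<dots> = (\<Sum>n\<le>M. card (H n c) * 2 ^ (k M - k n))"
      by (intro sum.cong refl card_words_prefix) (auto simp: H_def k_def)
    finally have "real (2 ^ k M) \<le> real (\<Sum>n\<le>M. card (H n c) * 2 ^ (k M - k n))"
      by (intro of_nat_mono) (simp add: card_words flip: numeral_2_eq_2)
    also have "\<dots> = (\<Sum>n\<le>M. real (card (H n c)) * 2 ^ (k M - k n))" by simp
    also have "\<dots> = (\<Sum>n\<le>M. 2 ^ k M * (real (card (H n c)) / 2 ^ k n))"
      by (intro sum.cong refl) (simp add: power_diff k_def)
    finally have "2 ^ k M * 1 \<le> 2 ^ k M * (\<Sum>n\<le>M. real (card (H n c)) / 2 ^ k n)"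
      by (simp add: sum_distrib_left)
    then show ?thesis by (rule mult_left_le_imp_le) simp
  qed
  have level: "(\<Sum>c\<in>F. p c * real (card (H n c))) / 2 ^ k n \<le> sqrt (9 * D * (A + 5)) * \<omega> ^ n"
    if n: "n \<le> M" for n
  proof -
    define S where "S = 2 ^ k n * ((A + 5) * (\<omega> ^ 4) ^ n)"
    have "(\<Sum>c\<in>F. p c * real (card (H n c))) \<le> sqrt (card (Q n) * S)"
      unfolding H_def
    proof (intro level_mass F finQ order.trans[OF energy_bound[OF F r l frostman[OF n] x q, folded k_def]])
      have "(3 / 4) ^ n \<le> (\<omega> ^ 4) ^ n" using \<omega> by (intro power_mono) auto
      moreover have "(A + 4) * ((1 + 2 * q) ^ (2 * l) * x ^ l / q ^ 3) ^ n \<le> (A + 4) * (\<omega> ^ 4) ^ n"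
        using \<omega> q x A by (intro mult_left_mono power_mono) auto
      ultimately have "(3 / 4) ^ n + (A + 4) * ((1 + 2 * q) ^ (2 * l) * x ^ l / q ^ 3) ^ n
        \<le> (A + 5) * (\<omega> ^ 4) ^ n"
        by (simp add: algebra_simps)
      then show "2 ^ k n * ((3 / 4) ^ n + (A + 4) * ((1 + 2 * q) ^ (2 * l) * x ^ l / q ^ 3) ^ n) \<le> S"
        unfolding S_def by (intro mult_left_mono) auto
    qed auto
    also have "\<dots> \<le> sqrt (9 * (D * (2 ^ (2 * l) / \<omega>\<^sup>2) ^ n) * S)"
      using cardQ A \<omega> by (intro real_sqrt_le_mono mult_right_mono) (auto simp: S_def)
    \<comment> \<open>Of the four powers of \<open>\<omega>\<close> gained in the energy, two pay
      for the excess of the count over \<open>2 ^ k n\<close>; the square root leaves one, which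
      makes the levels summable.\<close>
    also have "9 * (D * (2 ^ (2 * l) / \<omega>\<^sup>2) ^ n) * S = 9 * D * (A + 5) * (2 ^ k n * \<omega> ^ n)\<^sup>2"
    proof -
      have "(2 ^ (2 * l) / \<omega>\<^sup>2) ^ n * (2 ^ k n * (\<omega> ^ 4) ^ n) = (2 ^ (2 * l)) ^ n * 2 ^ k n * (\<omega> ^ 4 / \<omega>\<^sup>2) ^ n"
        by (simp add: power_divide)
      also have "(2 ^ (2 * l)) ^ n = (2 ^ k n :: real)"
        by (simp add: k_def mult.commute flip: power_mult)
      also have "\<omega> ^ 4 / \<omega>\<^sup>2 = \<omega>\<^sup>2"
        using \<omega> by (simp add: power_diff[symmetric])
      also have "2 ^ k n * 2 ^ k n * (\<omega>\<^sup>2) ^ n = (2 ^ k n * \<omega> ^ n)\<^sup>2"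
        by (simp add: power2_eq_square power_mult_distrib)
      finally show ?thesis by (simp add: S_def mult_ac)
    qed
    also have "sqrt \<dots> = sqrt (9 * D * (A + 5)) * (2 ^ k n * \<omega> ^ n)"
      using \<omega> by (simp add: real_sqrt_mult)
    finally show ?thesis by (simp add: field_simps)
  qed
  have "sum p F \<le> (\<Sum>c\<in>F. p c * (\<Sum>n\<le>M. real (card (H n c)) / 2 ^ k n))"
    using F(2) one mult_left_mono[OF one F(2)] by (intro sum_mono) simp
  also have "\<dots> = (\<Sum>c\<in>F. \<Sum>n\<le>M. p c * real (card (H n c)) / 2 ^ k n)"
    by (simp add: sum_distrib_left)
  also have "\<dots> = (\<Sum>n\<le>M. (\<Sum>c\<in>F. p c * real (card (H n c))) / 2 ^ k n)"
    by (subst sum.swap) (simp add: sum_divide_distrib)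
  also have "\<dots> \<le> (\<Sum>n\<le>M. sqrt (9 * D * (A + 5)) * \<omega> ^ n)"
    by (intro sum_mono level) simp
  also have "\<dots> = sqrt (9 * D * (A + 5)) * (\<Sum>n\<le>M. \<omega> ^ n)"
    by (simp add: sum_distrib_left)
  also have "\<dots> \<le> sqrt (9 * D * (A + 5)) * (1 / (1 - \<omega>))"
  proof (intro mult_left_mono)
    have "(\<Sum>n\<le>M. \<omega> ^ n) = (1 - \<omega> ^ Suc M) / (1 - \<omega>)"
      using \<omega> sum_gp_strict[of \<omega> "Suc M"] by (simp add: lessThan_Suc_atMost)
    then show "(\<Sum>n\<le>M. \<omega> ^ n) \<le> 1 / (1 - \<omega>)"
      using \<omega> by (simp add: divide_right_mono)
  qed (use D0 A in auto)
  finally show ?thesis by simp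
qed

text \<open>Division by \<open>a\<close> normalises the radii for \<open>mass_bound\<close>. Each
  \<open>d i / a\<close> is rounded up to a power of \<open>1 / 3 ^ (2 * l)\<close> with exponent
  \<open>\<nu> i\<close>; at level \<open>n\<close> it contributes at least
  \<open>1 / R ^ Suc n\<close> to the sum of \<open>(d i / a) powr t\<close>, which bounds the
  number of balls of that level.\<close>

lemma scaled_copies_mass_bound:
  fixes r :: "real \<Rightarrow> real" and centre d :: "nat \<Rightarrow> real"
  assumes E: "E \<subseteq> cell (0, q0)" and a: "0 < a" "10 * a \<le> 3 ^ g"
    and r: "\<And>c. c \<in> E \<Longrightarrow> a \<le> r c \<and> r c \<le> a * (1 + 1 / 3 ^ (2 * l))"
    and l: "0 < l" and x: "1 / 2 \<le> x" "x \<le> 1" and q: "0 < q" "q \<le> 1"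
    and \<omega>: "0 < \<omega>" "\<omega> < 1" "3 / 4 \<le> \<omega> ^ 4" "(1 + 2 * q) ^ (2 * l) * x ^ l / q ^ 3 \<le> \<omega> ^ 4"
    and t: "0 < t" "3 powr (2 * real l * t) = 2 ^ (2 * l) / \<omega>\<^sup>2"
    and d: "\<And>i. i < N \<Longrightarrow> 0 < d i" "\<And>i. i < N \<Longrightarrow> d i \<le> a"
    and sum_d: "(\<Sum>i<N. d i powr t) \<le> \<epsilon>"
    and cover: "\<And>c. c \<in> E \<Longrightarrow> scaled_copy (r c) c \<subseteq> (\<Union>i<N. ball (centre i) (d i))"
  shows "net_content x E
    \<le> ennreal (sqrt (9 * (\<epsilon> / a powr t * (2 ^ (2 * l) / \<omega>\<^sup>2)) * (2 / x ^ g + 5)) / (1 - \<omega>))"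
proof -
  define R where "R = (2 ^ (2 * l) / \<omega>\<^sup>2 :: real)"
  have R0: "0 < R" using \<omega> by (simp add: R_def)
  have Rpow: "(1 / 3 ^ (n * (2 * l))) powr t = 1 / R ^ n" for n
  proof -
    have "(1 / 3 ^ (n * (2 * l))) powr t = (3 powr - real (n * (2 * l))) powr t"
      by (simp add: powr_minus_divide powr_realpow del: of_nat_mult)
    also have "\<dots> = 3 powr - (2 * real l * t * real n)"
      by (simp add: powr_powr mult_ac)
    also have "\<dots> = 1 / (3 powr (2 * real l * t)) powr real n"
      by (simp add: powr_minus_divide powr_powr)
    also have "\<dots> = 1 / R ^ n"
      using R0 by (simp add: t(2) powr_realpow flip: R_def)
    finally show ?thesis .
  qed
  have "\<exists>n. 1 / 3 ^ (Suc n * (2 * l)) < d i / a \<and> d i / a \<le> 1 / 3 ^ (n * (2 * l))" if i: "i < N" for i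
  proof -
    define P where "P n \<longleftrightarrow> 1 / 3 ^ (n * (2 * l)) < d i / a" for n
    have "0 < d i / a" using d(1)[OF i] a by simp
    then obtain m where m: "(1 / 3) ^ m < d i / a"
      using real_arch_pow_inv[of "d i / a" "1 / 3"] by auto
    have "(1 / 3 :: real) ^ (m * (2 * l)) \<le> (1 / 3) ^ m"
      using l by (intro power_decreasing) auto
    then have "P m" using m by (simp add: P_def power_one_over)
    moreover have "\<not> P 0" using d(2)[OF i] a by (simp add: P_def)
    ultimately obtain n where "\<not> P n" "P (Suc n)"
      using ex_least_nat_less[of P m] by blast
    then show ?thesis by (auto simp: P_def not_less)
  qed
  then obtain \<nu> where \<nu>: "\<And>i. i < N \<Longrightarrow> 1 / 3 ^ (Suc (\<nu> i) * (2 * l)) < d i / a"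
    "\<And>i. i < N \<Longrightarrow> d i / a \<le> 1 / 3 ^ (\<nu> i * (2 * l))"
    by metis
  \<comment> \<open>Any common upper bound of the finitely many levels serves as the word
    depth.\<close>
  define M where "M = (\<Sum>i<N. \<nu> i)"
  have M: "\<nu> i \<le> M" if "i < N" for i
    unfolding M_def using that by (intro member_le_sum) auto
  have count: "real (card {i. i < N \<and> \<nu> i = n}) \<le> \<epsilon> / a powr t * R * R ^ n" for n
  proof -
    let ?I = "{i. i < N \<and> \<nu> i = n}"
    have "real (card ?I) * (1 / R ^ Suc n) = (\<Sum>i\<in>?I. 1 / R ^ Suc n)" by simp
    also have "\<dots> \<le> (\<Sum>i\<in>?I. (d i / a) powr t)"
    proof (rule sum_mono)
      fix i assume i: "i \<in> ?I"
      then have "1 / 3 ^ (Suc n * (2 * l)) \<le> d i / a" using \<nu>(1)[of i] by auto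
      then have "(1 / 3 ^ (Suc n * (2 * l))) powr t \<le> (d i / a) powr t"
        using t by (intro powr_mono2) auto
      then show "1 / R ^ Suc n \<le> (d i / a) powr t" unfolding Rpow .
    qed
    also have "\<dots> \<le> (\<Sum>i<N. (d i / a) powr t)"
      by (intro sum_mono2) auto
    also have "\<dots> = (\<Sum>i<N. d i powr t) / a powr t"
      unfolding sum_divide_distrib powr_divide ..
    also have "\<dots> \<le> \<epsilon> / a powr t"
      using sum_d by (intro divide_right_mono) auto
    finally show ?thesis using R0 by (simp add: field_simps)
  qed
  obtain F p where Fp: "finite F" "F \<subseteq> E" "\<And>c. 0 \<le> p c" "sum p F \<le> 1"
    "net_content x E \<le> ennreal (sum p F)"
    "\<And>m z. m \<le> M * l \<Longrightarrow> (\<Sum>c\<in>{c \<in> F. \<bar>c - z\<bar> \<le> 5 * a / 3 ^ m}. p c) \<le> 2 / x ^ g * x ^ m"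
    using net_frostman_intervals[OF _ x(2) E a, of "M * l"] x(1) by auto
  have inj: "inj_on (\<lambda>c. c / a) A" for A
    using a by (auto simp: inj_on_def)
  have sum_scale: "(\<Sum>c\<in>(\<lambda>c. c / a) ` A. p (a * c)) = sum p A" for A
    using a by (subst sum.reindex[OF inj]) (auto simp: comp_def)
  have "sum (\<lambda>c. p (a * c)) ((\<lambda>c. c / a) ` F)
    \<le> sqrt (9 * (\<epsilon> / a powr t * R) * (2 / x ^ g + 5)) / (1 - \<omega>)"
  proof (rule mass_bound[where r = "\<lambda>c. r (a * c) / a" and M = M and \<nu> = \<nu> and N = N
        and l = l and x = x and q = q and centre = "\<lambda>i. centre i / a"])
    show "finite ((\<lambda>c. c / a) ` F)" using Fp(1) by simp
    show "0 \<le> p (a * c)" for c by (rule Fp(3))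
    show "sum (\<lambda>c. p (a * c)) ((\<lambda>c. c / a) ` F) \<le> 1"
      unfolding sum_scale by (rule Fp(4))
    show "1 \<le> r (a * c) / a \<and> r (a * c) / a \<le> 1 + 1 / 3 ^ (2 * l)" if c: "c \<in> (\<lambda>c. c / a) ` F" for c
    proof -
      obtain c' where "c' \<in> F" "c = c' / a" using c by auto
      then show ?thesis
        using r[of c'] Fp(2) a by (auto simp: pos_le_divide_eq pos_divide_le_eq mult.commute)
    qed
    show "(\<Sum>c\<in>{c \<in> (\<lambda>c. c / a) ` F. \<bar>c - z\<bar> \<le> 5 / 3 ^ (n * l)}. p (a * c)) \<le> 2 / x ^ g * x ^ (n * l)"
      if n: "n \<le> M" for n z
    proof -
      have "\<bar>c / a - z\<bar> \<le> 5 / 3 ^ (n * l) \<longleftrightarrow> \<bar>c - a * z\<bar> \<le> 5 * a / 3 ^ (n * l)" for c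
      proof -
        have "\<bar>c - a * z\<bar> = a * \<bar>c / a - z\<bar>"
          using a by (simp add: abs_mult_pos' right_diff_distrib)
        moreover have "5 * a / 3 ^ (n * l) = a * (5 / 3 ^ (n * l))" by simp
        ultimately show ?thesis using a by (simp only: mult_le_cancel_left_pos)
      qed
      then have "{c \<in> (\<lambda>c. c / a) ` F. \<bar>c - z\<bar> \<le> 5 / 3 ^ (n * l)}
        = (\<lambda>c. c / a) ` {c \<in> F. \<bar>c - a * z\<bar> \<le> 5 * a / 3 ^ (n * l)}"
        by auto
      then show ?thesis
        using Fp(6)[of "n * l" "a * z"] n by (simp only: sum_scale mult_le_mono1)
    qed
    show "0 \<le> 2 / x ^ g" using x by simp
    show "\<exists>i<N. \<bar>copy_point (r (a * c) / a) c w - centre i / a\<bar> \<le> 1 / 3 ^ (\<nu> i * (2 * l))"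
      if c: "c \<in> (\<lambda>c. c / a) ` F" and w: "w \<in> words {0, 1} (M * (2 * l))" for c w
    proof -
      obtain c' where c': "c' \<in> F" "c = c' / a" using c by auto
      have "copy_point (r c') c' w \<in> (\<Union>i<N. ball (centre i) (d i))"
        using copy_point_in_scaled_copy[OF w] cover[of c'] c'(1) Fp(2) by blast
      then obtain i where i: "i < N" "\<bar>copy_point (r c') c' w - centre i\<bar> < d i"
        by (auto simp: dist_real_def abs_minus_commute)
      have "copy_point (r (a * c) / a) c w - centre i / a = (copy_point (r c') c' w - centre i) / a"
        using a c' by (simp add: copy_point_def diff_divide_distrib add_divide_distrib)
      also have "\<bar>\<dots>\<bar> \<le> d i / a"
        using i(2) a by (simp add: divide_right_mono)
      also have "\<dots> \<le> 1 / 3 ^ (\<nu> i * (2 * l))" by (rule \<nu>(2)[OF i(1)])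
      finally show ?thesis using i(1) by blast
    qed
    show "real (card {i. i < N \<and> \<nu> i = n}) \<le> \<epsilon> / a powr t * R * (2 ^ (2 * l) / \<omega>\<^sup>2) ^ n" for n
      using count[of n] by (simp add: R_def)
  qed (use M l x q \<omega> in auto)
  then have "sum p F \<le> sqrt (9 * (\<epsilon> / a powr t * R) * (2 / x ^ g + 5)) / (1 - \<omega>)"
    unfolding sum_scale .
  then show ?thesis
    using Fp(5) unfolding R_def by (meson ennreal_leI order.trans)
qed

section \<open>Reduction to centres with comparable radii, and the contradiction with a null
  cover\<close>

lemma countable_cases_not_net_null:
  fixes f :: "real \<Rightarrow> 'i::countable"
  assumes "net_content x C \<noteq> 0"
  obtains i where "net_content x {c \<in> C. f c = i} \<noteq> 0"
proof -
  define E where "E n = {c \<in> C. to_nat (f c) = n}" for n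
  have "\<exists>n. net_content x (E n) \<noteq> 0"
  proof (rule ccontr)
    assume "\<nexists>n. net_content x (E n) \<noteq> 0"
    then have "net_content x (\<Union>n. E n) \<le> (\<Sum>n. 0)"
      using net_content_UN[of x E] by simp
    moreover have "(\<Union>n. E n) = C" by (auto simp: E_def)
    ultimately show False using assms by simp
  qed
  then obtain n where n: "net_content x (E n) \<noteq> 0" by auto
  then have "E n \<noteq> {}" by auto
  then obtain c where "c \<in> C" "n = to_nat (f c)" by (auto simp: E_def)
  then have "E n = {c' \<in> C. f c' = f c}" by (auto simp: E_def)
  then show ?thesis using n that by auto
qed

text \<open>Grouping by the integer part of the logarithm to base \<open>1 + \<tau>\<close> yields
  countably many classes, in each of which the radii agree up to the factor
  \<open>1 + \<tau>\<close>.\<close>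

lemma geometric_class:
  fixes r \<tau> :: real
  assumes "0 < r" "0 < \<tau>"
  defines "j \<equiv> \<lfloor>ln r / ln (1 + \<tau>)\<rfloor>"
  shows "(1 + \<tau>) powr of_int j \<le> r" "r \<le> (1 + \<tau>) powr of_int j * (1 + \<tau>)"
proof -
  have ln0: "0 < ln (1 + \<tau>)" using assms by simp
  have r: "r = (1 + \<tau>) powr (ln r / ln (1 + \<tau>))"
    using assms ln0 by (simp add: powr_def)
  have "(1 + \<tau>) powr of_int j \<le> (1 + \<tau>) powr (ln r / ln (1 + \<tau>))"
    using assms by (intro powr_mono) (auto simp: j_def)
  then show "(1 + \<tau>) powr of_int j \<le> r" using r by simp
  have "(1 + \<tau>) powr (ln r / ln (1 + \<tau>)) \<le> (1 + \<tau>) powr (of_int j + 1)"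
    using assms by (intro powr_mono) (auto simp: j_def)
  then show "r \<le> (1 + \<tau>) powr of_int j * (1 + \<tau>)"
    using r assms by (simp add: powr_add)
qed

text \<open>A null \<open>Y\<close> has arbitrarily cheap covers by open balls. For a class
  \<open>E\<close> of centres of content \<open>h > 0\<close>, a cheap enough cover leaves content
  at most \<open>h / 2\<close> to the centres whose copies lie in the first \<open>N\<close> balls,
  for every \<open>N\<close>; \<open>net_content_incseq\<close> then bounds the content of
  \<open>E\<close> by \<open>h / 2\<close>.\<close>

lemma hausdorff_measure_pos_of_scaled_copies:
  fixes C Y :: "real set"
  assumes C: "net_content x C \<noteq> 0"
    and Y: "\<And>c. c \<in> C \<Longrightarrow> \<exists>r>0. scaled_copy r c \<subseteq> Y"
    and l: "0 < l" and x: "1 / 2 \<le> x" "x \<le> 1" and q: "0 < q" "q \<le> 1"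
    and \<omega>: "0 < \<omega>" "\<omega> < 1" "3 / 4 \<le> \<omega> ^ 4" "(1 + 2 * q) ^ (2 * l) * x ^ l / q ^ 3 \<le> \<omega> ^ 4"
    and t: "0 < t" "3 powr (2 * real l * t) = 2 ^ (2 * l) / \<omega>\<^sup>2"
    and t': "0 \<le> t'" "t' \<le> t"
  shows "hausdorff_measure t' Y \<noteq> 0"
proof
  assume null: "hausdorff_measure t' Y = 0"
  define \<tau> where "\<tau> = (1 / 3 ^ (2 * l) :: real)"
  have \<tau>: "0 < \<tau>" by (simp add: \<tau>_def)
  obtain r where r: "\<And>c. c \<in> C \<Longrightarrow> 0 < r c" "\<And>c. c \<in> C \<Longrightarrow> scaled_copy (r c) c \<subseteq> Y"
    using Y by metis
  obtain i where "net_content x {c \<in> C. (\<lfloor>ln (r c) / ln (1 + \<tau>)\<rfloor>, \<lfloor>c\<rfloor>) = i} \<noteq> 0"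
    using countable_cases_not_net_null[OF C, of "\<lambda>c. (\<lfloor>ln (r c) / ln (1 + \<tau>)\<rfloor>, \<lfloor>c\<rfloor>)"] .
  then obtain j q0 where "net_content x {c \<in> C. (\<lfloor>ln (r c) / ln (1 + \<tau>)\<rfloor>, \<lfloor>c\<rfloor>) = (j, q0)} \<noteq> 0"
    by (cases i) auto
  then obtain E where E: "E \<subseteq> C" "E \<subseteq> cell (0, q0)" "net_content x E \<noteq> 0"
    "\<And>c. c \<in> E \<Longrightarrow> \<lfloor>ln (r c) / ln (1 + \<tau>)\<rfloor> = j"
    by (intro that[of "{c \<in> C. (\<lfloor>ln (r c) / ln (1 + \<tau>)\<rfloor>, \<lfloor>c\<rfloor>) = (j, q0)}"])
      (auto simp: cell_def)
  define a where "a = (1 + \<tau>) powr of_int j"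
  have a: "0 < a" using \<tau> by (simp add: a_def)
  have ra: "a \<le> r c \<and> r c \<le> a * (1 + 1 / 3 ^ (2 * l))" if "c \<in> E" for c
    using geometric_class[OF r(1) \<tau>, of c] E(1,4) that by (auto simp: a_def \<tau>_def)
  obtain g where "10 * a < 3 ^ g"
    using real_arch_pow[of 3 "10 * a"] by auto
  then have g: "10 * a \<le> 3 ^ g" by simp
  \<comment> \<open>The content of \<open>E\<close> is finite, being at most the cost 1 of the unit
    cell that contains \<open>E\<close>.\<close>
  define h where "h = enn2real (net_content x E)"
  have hE: "net_content x E = ennreal h"
    using net_content_cell[OF E(2), of x] unfolding h_def
    by (intro ennreal_enn2real[symmetric]) (auto simp: less_top[symmetric] top_unique)
  have h: "0 < h" using E(3) hE by (metis ennreal_neg ennreal_0 not_le)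
  define B where "B = 2 / x ^ g + 5"
  have B: "0 < B" using x by (simp add: B_def add_nonneg_pos)
  define R where "R = (2 ^ (2 * l) / \<omega>\<^sup>2 :: real)"
  have R: "0 < R" using \<omega> by (simp add: R_def)
  \<comment> \<open>\<open>D\<close> solves
    \<open>sqrt (9 * D * B) / (1 - \<omega>) = h / 2\<close>.\<close>
  define D where "D = (h / 2 * (1 - \<omega>))\<^sup>2 / (9 * B)"
  have D: "0 < D" using h B \<omega> by (simp add: D_def)
  \<comment> \<open>The first bound on the cost forces every radius to be at most \<open>a\<close>;
    the second gives \<open>\<epsilon> / a powr t * R \<le> D\<close>.\<close>
  define \<epsilon> where "\<epsilon> = min (a powr t) (D * a powr t / R)"
  have \<epsilon>: "0 < \<epsilon>" using a D R by (simp add: \<epsilon>_def)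
  obtain d and v :: "nat \<Rightarrow> real" where d: "\<And>i. 0 < d i" "\<And>N. (\<Sum>i<N. d i powr t) \<le> \<epsilon>"
    "Y \<subseteq> (\<Union>i. ball (v i) (d i))"
  proof (rule hausdorff_null_imp_balls[OF null t' t(1) \<epsilon>])
    fix d v :: "nat \<Rightarrow> real"
    assume "\<And>i. 0 < d i" "\<And>N. (\<Sum>i<N. d i powr t) \<le> \<epsilon>" "Y \<subseteq> (\<Union>i. ball (v i) (d i))"
    then show thesis by (rule that)
  qed
  have da: "d i \<le> a" for i
  proof (rule ccontr)
    assume "\<not> d i \<le> a"
    then have "a powr t < d i powr t" using a t by (intro powr_less_mono2) auto
    also have "\<dots> \<le> (\<Sum>i<Suc i. d i powr t)"
      by (intro member_le_sum) auto
    also have "\<dots> \<le> \<epsilon>" by (rule d)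
    finally show False by (simp add: \<epsilon>_def)
  qed
  \<comment> \<open>These sets exhaust \<open>E\<close>, since each copy is compact and so has a
    finite subcover.\<close>
  define EN where "EN N = {c \<in> E. scaled_copy (r c) c \<subseteq> (\<Union>i<N. ball (v i) (d i))}" for N
  have "incseq EN"
    unfolding EN_def by (intro incseq_SucI) (auto simp: lessThan_Suc)
  moreover have "net_content x (EN N) \<le> ennreal (h / 2)" for N
  proof -
    have "net_content x (EN N)
      \<le> ennreal (sqrt (9 * (\<epsilon> / a powr t * (2 ^ (2 * l) / \<omega>\<^sup>2)) * (2 / x ^ g + 5)) / (1 - \<omega>))"
    proof (rule scaled_copies_mass_bound[where N = N and q = q and d = d])
      show "EN N \<subseteq> cell (0, q0)" using E(2) by (auto simp: EN_def)
      show "a \<le> r c \<and> r c \<le> a * (1 + 1 / 3 ^ (2 * l))" if "c \<in> EN N" for c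
        using that by (intro ra) (auto simp: EN_def)
      show "scaled_copy (r c) c \<subseteq> (\<Union>i<N. ball (v i) (d i))" if "c \<in> EN N" for c
        using that by (simp add: EN_def)
      show "0 < d i" "d i \<le> a" for i by (rule d(1), rule da)
      show "(\<Sum>i<N. d i powr t) \<le> \<epsilon>" by (rule d(2))
    qed fact+
    also have "\<dots> \<le> ennreal (h / 2)"
    proof (rule ennreal_leI)
      have "\<epsilon> / a powr t * R \<le> (D * a powr t / R) / a powr t * R"
        using R unfolding \<epsilon>_def by (intro mult_right_mono divide_right_mono min.cobounded2) auto
      then have "\<epsilon> / a powr t * R \<le> D"
        using a R by simp
      then have "9 * (\<epsilon> / a powr t * R) * B \<le> 9 * D * B"
        using B by (intro mult_left_mono mult_right_mono) auto
      also have "\<dots> = (h / 2 * (1 - \<omega>))\<^sup>2" using B by (simp add: D_def)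
      finally have "sqrt (9 * (\<epsilon> / a powr t * R) * B) \<le> h / 2 * (1 - \<omega>)"
        using h \<omega> by (intro real_le_lsqrt) auto
      then show "sqrt (9 * (\<epsilon> / a powr t * (2 ^ (2 * l) / \<omega>\<^sup>2)) * (2 / x ^ g + 5)) / (1 - \<omega>) \<le> h / 2"
        using \<omega> by (simp add: R_def B_def pos_divide_le_eq)
    qed
    finally show ?thesis .
  qed
  ultimately have "net_content x (\<Union>N. EN N) \<le> ennreal (h / 2)"
    by (rule net_content_incseq)
  moreover have "(\<Union>N. EN N) = E"
  proof -
    have "\<exists>N. c \<in> EN N" if c: "c \<in> E" for c
    proof -
      have "scaled_copy (r c) c \<subseteq> (\<Union>i\<in>UNIV. ball (v i) (d i))"
        using r(2)[of c] E(1) c d(3) by blast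
      then obtain I where I: "finite I" "scaled_copy (r c) c \<subseteq> (\<Union>i\<in>I. ball (v i) (d i))"
        using compactE_image[OF compact_scaled_copy, of UNIV "\<lambda>i. ball (v i) (d i)"]
        by (metis open_ball)
      obtain N where "I \<subseteq> {..<N}"
        using finite_nat_bounded[OF I(1)] by auto
      then have "c \<in> EN N" using I(2) c unfolding EN_def by blast
      then show ?thesis ..
    qed
    then show ?thesis by (auto simp: EN_def)
  qed
  ultimately have "ennreal h \<le> ennreal (h / 2)" using hE by simp
  then show False using h by (simp add: ennreal_le_iff)
qed

theorem theorem3:
  fixes s :: real
  assumes "s > 0"
  shows "\<exists>\<delta>::real. \<delta> > 0 \<and>
    (\<forall>C Y :: real set.
       compact C \<longrightarrow> hausdorff_dim C = ennreal s \<longrightarrow>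
       (\<forall>c\<in>C. \<exists>r>0. scaled_copy r c \<subseteq> Y) \<longrightarrow>
       hausdorff_dim Y > hausdorff_dim centered_cantor_set + ennreal \<delta>)"
proof -
  \<comment> \<open>Being below \<open>s\<close> ensures that \<open>C\<close> is not null in
    dimension \<open>s'\<close>; being at most 1/2 ensures \<open>1 / 2 \<le> x\<close>.\<close>
  define s' where "s' = min (s / 2) (1 / 2)"
  define x where "x = 3 powr - s'"
  have s': "0 < s'" "s' \<le> 1 / 2" "s' < s" using assms by (auto simp: s'_def)
  have x1: "x < 1" unfolding x_def using s' powr_less_mono[of "- s'" 0 3] by simp
  have x2: "1 / 2 \<le> x"
  proof -
    have "sqrt 3 \<le> sqrt 4" by (intro real_sqrt_le_mono) simp
    then have "1 / 2 \<le> 1 / sqrt 3" by (intro divide_left_mono) auto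
    also have "\<dots> = 3 powr - (1 / 2)" by (simp add: powr_minus_divide powr_half_sqrt)
    also have "\<dots> \<le> x" unfolding x_def using s' by (intro powr_mono) auto
    finally show ?thesis .
  qed
  \<comment> \<open>Small enough for
    \<open>(1 + 2 * q)\<^sup>2 \<le> 1 + 8 * q < 1 / x\<close>.\<close>
  define q where "q = min 1 ((1 / x - 1) / 16)"
  have q: "0 < q" "q \<le> 1" using x1 x2 by (auto simp: q_def)
  have q16: "q \<le> (1 / x - 1) / 16" unfolding q_def by (rule min.cobounded2)
  define \<beta> where "\<beta> = (1 + 2 * q)\<^sup>2 * x"
  have \<beta>: "0 \<le> \<beta>" "\<beta> < 1"
  proof -
    have "q * q \<le> q" using q by (simp add: mult_left_le)
    then have "(1 + 2 * q)\<^sup>2 \<le> 1 + 8 * q" by (simp add: power2_eq_square algebra_simps)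
    also have "\<dots> < 1 / x" using q16 x1 x2 by (simp add: field_simps)
    finally show "\<beta> < 1" using x2 by (simp add: \<beta>_def field_simps)
    show "0 \<le> \<beta>" using x2 by (simp add: \<beta>_def)
  qed
  \<comment> \<open>A long window makes the loss \<open>1 / q ^ 3\<close>, incurred once per window,
    negligible against the decay of \<open>\<beta> ^ l\<close>.\<close>
  obtain l where l: "\<beta> ^ l < q ^ 3"
    using real_arch_pow_inv[of "q ^ 3" \<beta>] \<beta> q by auto
  have l0: "0 < l"
  proof (rule ccontr)
    assume "\<not> 0 < l"
    then show False using l q power_le_one[of q 3] by simp
  qed
  \<comment> \<open>The larger of the two decay rates per window in \<open>energy_bound\<close>. Its
    fourth root is taken because \<open>mass_bound\<close> spends two powers of
    \<open>\<omega>\<close> on the count of balls and halves the rest by a square root.\<close>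
  define \<theta> where "\<theta> = max (3 / 4) (\<beta> ^ l / q ^ 3)"
  have \<theta>: "0 < \<theta>" "\<theta> < 1" using l q by (auto simp: \<theta>_def less_max_iff_disj)
  define \<omega> where "\<omega> = \<theta> powr (1 / 4)"
  have \<omega>4: "\<omega> ^ 4 = \<theta>" using \<theta> by (simp add: \<omega>_def powr_power)
  have \<omega>: "0 < \<omega>" "\<omega> < 1"
    using \<theta> powr_less_mono2[of "1 / 4" \<theta> 1] by (auto simp: \<omega>_def)
  have ratio: "(1 + 2 * q) ^ (2 * l) * x ^ l / q ^ 3 \<le> \<omega> ^ 4" "3 / 4 \<le> \<omega> ^ 4"
    by (simp_all add: \<omega>4 \<theta>_def \<beta>_def power_mult_distrib power_mult)
  \<comment> \<open>The solution of the equation \<open>dim\<close>, positive because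
    \<open>\<omega>\<close> is below 1. As \<open>s'\<close>, \<open>x\<close>, \<open>q\<close>,
    \<open>l\<close> and \<open>\<omega>\<close> are obtained from \<open>s\<close> alone, so is
    \<open>\<eta>\<close>.\<close>
  define \<eta> where "\<eta> = - ln (\<omega>\<^sup>2) / (2 * real l * ln 3)"
  define \<gamma> :: real where "\<gamma> = ln 2 / ln 3"
  have \<eta>: "0 < \<eta>"
    using \<omega> l0 by (auto simp: \<eta>_def ln_realpow divide_neg_pos mult_less_0_iff)
  have \<gamma>: "0 < \<gamma>" by (simp add: \<gamma>_def)
  have dim: "3 powr (2 * real l * (\<gamma> + \<eta>)) = 2 ^ (2 * l) / \<omega>\<^sup>2"
  proof -
    have "2 * real l * (\<gamma> + \<eta>) * ln 3 = real (2 * l) * ln 2 - ln (\<omega>\<^sup>2)"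
      using l0 by (simp add: \<gamma>_def \<eta>_def field_simps)
    then have "3 powr (2 * real l * (\<gamma> + \<eta>)) = exp (real (2 * l) * ln 2 - ln (\<omega>\<^sup>2))"
      by (simp add: powr_def)
    also have "\<dots> = 2 ^ (2 * l) / \<omega>\<^sup>2"
      using \<omega> by (simp only: exp_diff exp_of_nat_mult) simp
    finally show ?thesis .
  qed
  show ?thesis
  \<comment> \<open>Halving \<open>\<eta>\<close> leaves room for strictness: if the claim fails,
    some exponent below \<open>\<gamma> + \<eta>\<close> has measure zero on
    \<open>Y\<close>.\<close>
  proof (intro exI[of _ "\<eta> / 2"] conjI allI impI)
    show "0 < \<eta> / 2" using \<eta> by simp
    fix C Y :: "real set"
    assume dimC: "hausdorff_dim C = ennreal s" and Y: "\<forall>c\<in>C. \<exists>r>0. scaled_copy r c \<subseteq> Y"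
    have C: "net_content x C \<noteq> 0"
    proof
      assume "net_content x C = 0"
      then have "hausdorff_measure s' C = 0"
        unfolding x_def using s' by (intro hausdorff_measure_net_null)
      then have "hausdorff_dim C \<le> ennreal s'"
        unfolding hausdorff_dim_def using s' by (intro Inf_lower) auto
      then show False using dimC s' assms by (simp add: ennreal_le_iff)
    qed
    show "hausdorff_dim centered_cantor_set + ennreal (\<eta> / 2) < hausdorff_dim Y"
    proof (rule ccontr)
      assume "\<not> ?thesis"
      then have "hausdorff_dim Y \<le> hausdorff_dim centered_cantor_set + ennreal (\<eta> / 2)" by simp
      also have "\<dots> \<le> ennreal \<gamma> + ennreal (\<eta> / 2)"
        unfolding \<gamma>_def by (intro add_right_mono hausdorff_dim_cantor_le)
      also have "\<dots> = ennreal (\<gamma> + \<eta> / 2)"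
        using \<gamma> \<eta> by (simp add: ennreal_plus)
      also have "\<dots> < ennreal (\<gamma> + \<eta>)"
        using \<gamma> \<eta> by (simp add: ennreal_less_iff)
      finally obtain t' where t': "0 \<le> t'" "hausdorff_measure t' Y = 0" "t' < \<gamma> + \<eta>"
        unfolding hausdorff_dim_def Inf_less_iff by (auto simp: ennreal_less_iff)
      moreover have "hausdorff_measure t' Y \<noteq> 0"
      proof (rule hausdorff_measure_pos_of_scaled_copies[where x = x and q = q and \<omega> = \<omega>
            and l = l and t = "\<gamma> + \<eta>", OF C])
        show "\<exists>r>0. scaled_copy r c \<subseteq> Y" if "c \<in> C" for c using Y that by blast
        show "0 < \<gamma> + \<eta>" "t' \<le> \<gamma> + \<eta>" "x \<le> 1" using \<gamma> \<eta> t' x1 by auto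
      qed fact+
      ultimately show False by simp
    qed
  qed
qed

end
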